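(* Let $q$ be an integer with $|q|\neq 0,1$, and let $$Ln_q(2)=\sum_{n=1}^{\infty}\frac{(-1)^n}{q^n-1}.$$ Then $Ln_q(2)$ is irrational, and its irrationality measure is at most $4.8$.
   Context: The irrationality measure $\mu(x)$ of a real number $x$ is the infimum of all $\mu$ such that $\left|x-\frac{p}{r}\right|<\frac{1}{r^{\mu}}$ has only finitely many solutions in integers $p$ and $r\ge 1$. *)

theory Defs
  imports "HOL-Analysis.Analysis" "HOL-Library.Extended_Real"
begin

text \<open>Irrationality measure: the infimum (in the extended reals) of all real mu such that
  |x - p/r| < 1/r^mu has only finitely many solutions (p, r) with p, r integers, r >= 1.
  The infimum of the empty set is +infinity.\<close>
definition irrationality_measure :: "real \<Rightarrow> ereal" where
  "irrationality_measure x =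
     Inf {ereal mu | mu. finite {(p :: int, r :: int). r \<ge> 1 \<and>
            \<bar>x - real_of_int p / real_of_int r\<bar> < 1 / (real_of_int r) powr mu}}"

definition Ln_q2 :: "int \<Rightarrow> real" where
  "Ln_q2 q = (\<Sum>n. (-1) ^ (Suc n) / (real_of_int q ^ (Suc n) - 1))"

end

theory Submission
  imports Defs "HOL-Real_Asymp.Real_Asymp"
begin

text \<open>
  Put \<open>p = q\<close> and let \<open>G\<^sub>n(z) = (\<Prod>i=1..n. p\<^sup>i z - 1) / (\<Prod>l\<le>n. p\<^sup>l - z)\<close>, which vanishes at
  \<open>z = p\<^sup>-\<^sup>s\<close> for \<open>1 \<le> s \<le> n\<close>. Expanding \<open>G\<^sub>n\<close> in partial fractions turns the remainder
  \<open>R\<^sub>n = (\<Sum>s\<ge>1. (-1)\<^sup>s p\<^sup>-\<^sup>n\<^sup>s G\<^sub>n(p\<^sup>-\<^sup>s))\<close> into a linear form \<open>P\<^sub>n Ln\<^sub>q(2) - Q\<^sub>n\<close>, in which \<open>P\<^sub>n\<close>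
  is an integer and \<open>Q\<^sub>n\<close> has only denominators \<open>p\<^sup>k - 1\<close> and \<open>p\<^sup>k + 1\<close> with \<open>k \<le> n\<close>. For \<open>n = 2m\<close>
  all of these divide \<open>(\<Prod>m<j\<le>2m. p\<^sup>2\<^sup>j - 1)\<close>, which has size \<open>\<bar>p\<bar>\<close> to the power \<open>3m\<^sup>2 + O(m)\<close>, whereas
  \<open>P\<^sub>n\<close> is at most \<open>\<bar>p\<bar>\<close> to the power \<open>6m\<^sup>2 + O(m)\<close>. The first nonzero term dominates \<open>R\<^sub>n\<close>, so that
  \<open>\<bar>R\<^sub>n\<bar>\<close> is \<open>\<bar>p\<bar>\<close> to the power \<open>-6m\<^sup>2 + O(m)\<close>. After clearing denominators, these forms have
  coefficients of order \<open>9m\<^sup>2\<close> and values of order \<open>-3m\<^sup>2\<close> in the exponent, and in fact give the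
  measure \<open>1 + 9/3 = 4\<close>.
\<close>

section \<open>Gaussian binomial coefficients and q-differences\<close>

text \<open>The Gaussian binomial coefficient, given by a Pascal rule instead of a quotient of
  products, so that it is visibly an integer for integral \<open>p\<close>.\<close>

fun qbin :: "'a::comm_ring_1 \<Rightarrow> nat \<Rightarrow> nat \<Rightarrow> 'a" where
  "qbin p n 0 = 1"
| "qbin p 0 (Suc k) = 0"
| "qbin p (Suc n) (Suc k) = qbin p n (Suc k) + p ^ (n - k) * qbin p n k"

lemma qbin_eq_0: "n < k \<Longrightarrow> qbin p n k = 0"
  by (induction p n k rule: qbin.induct) auto

lemma qbin_in_Ints: "p \<in> \<int> \<Longrightarrow> qbin p n k \<in> \<int>" for p :: real
  by (induction p n k rule: qbin.induct) auto

text \<open>The product formula, free of division. Both summands of the Pascal rule are multiples of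
  the same product, and their cofactors \<open>p ^ (n - k) - 1\<close> and
  \<open>p ^ (n - k) * (p ^ Suc k - 1)\<close> add up to \<open>p ^ Suc n - 1\<close>.\<close>

lemma qbin_mult_prod:
  fixes p :: "'a::comm_ring_1"
  assumes "k \<le> n"
  shows "qbin p n k * (\<Prod>i=1..k. p ^ i - 1) = (\<Prod>i=1..k. p ^ (n - k + i) - 1)"
  using assms
proof (induction p n k rule: qbin.induct)
  case (3 p n k)
  have k: "qbin p n k * (\<Prod>i=1..k. p ^ i - 1) = (\<Prod>i=1..k. p ^ (n - k + i) - 1)"
    using 3 by simp
  \<comment> \<open>For \<open>k = n\<close> both sides vanish, the right one through its factor
    \<open>p ^ 0 - 1\<close>.\<close>
  have *: "qbin p n (Suc k) * (\<Prod>i=1..Suc k. p ^ i - 1)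
      = (p ^ (n - k) - 1) * (\<Prod>i=1..k. p ^ (n - k + i) - 1)"
  proof (cases "k = n")
    case True
    then show ?thesis by (simp add: qbin_eq_0)
  next
    case False
    then have "qbin p n (Suc k) * (\<Prod>i=1..Suc k. p ^ i - 1)
        = (\<Prod>i=1..Suc k. p ^ (n - Suc k + i) - 1)"
      using 3 by simp
    also have "\<dots> = (p ^ (n - k) - 1) * (\<Prod>i=2..Suc k. p ^ (n - Suc k + i) - 1)"
      using False 3(3) by (simp add: prod.atLeast_Suc_atMost numeral_2_eq_2)
    also have "(\<Prod>i=2..Suc k. p ^ (n - Suc k + i) - 1) = (\<Prod>i=1..k. p ^ (n - k + i) - 1)"
      by (rule prod.reindex_bij_witness[of _ Suc "\<lambda>i. i - 1"])
         (use False 3(3) in \<open>auto simp: Suc_diff_Suc numeral_2_eq_2\<close>)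
    finally show ?thesis .
  qed
  have "qbin p (Suc n) (Suc k) * (\<Prod>i=1..Suc k. p ^ i - 1)
      = (p ^ (n - k) - 1 + p ^ (n - k) * (p ^ Suc k - 1)) * (\<Prod>i=1..k. p ^ (n - k + i) - 1)"
  proof -
    define E where "E = (\<Prod>i=1..Suc k. p ^ i - 1)"
    have E: "E = (\<Prod>i=1..k. p ^ i - 1) * (p ^ Suc k - 1)" by (simp add: E_def)
    have "qbin p (Suc n) (Suc k) * E = qbin p n (Suc k) * E + p ^ (n - k) * qbin p n k * E"
      by (simp add: distrib_right)
    also have "p ^ (n - k) * qbin p n k * E
       = p ^ (n - k) * (p ^ Suc k - 1) * (qbin p n k * (\<Prod>i=1..k. p ^ i - 1))"
      unfolding E by (simp only: mult_ac)
    also have "qbin p n (Suc k) * E = (p ^ (n - k) - 1) * (\<Prod>i=1..k. p ^ (n - k + i) - 1)"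
      unfolding E_def by (rule *)
    finally show ?thesis unfolding k E_def distrib_right .
  qed
  also have "p ^ (n - k) - 1 + p ^ (n - k) * (p ^ Suc k - 1) = p ^ (n - k + Suc k) - 1"
    by (simp add: algebra_simps power_add)
  finally show ?case by simp
qed auto

text \<open>
  By the \<open>q\<close>-binomial theorem this is \<open>\<Prod>s<m. (1 - p\<^sup>s y E)\<close> applied to \<open>g\<close> and evaluated at \<open>0\<close>,
  where \<open>E\<close> is the shift \<open>(E g) j = g (j + 1)\<close>.
\<close>
definition qdiff :: "real \<Rightarrow> nat \<Rightarrow> real \<Rightarrow> (nat \<Rightarrow> real) \<Rightarrow> real" where
  "qdiff p m y g = (\<Sum>j\<le>m. (-1) ^ j * p ^ (j choose 2) * y ^ j * qbin p m j * g j)"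

lemma Suc_choose_two: "Suc j choose 2 = j + (j choose 2)"
  by (simp add: numeral_2_eq_2)

text \<open>Splits off the factor \<open>1 - p^m y E\<close>. The Pascal rule gives this, since
  \<open>p ^ (Suc j choose 2)\<close> supplies the \<open>p ^ j\<close> that turns
  \<open>p ^ (m - j)\<close> into \<open>p ^ m\<close>.\<close>

lemma qdiff_Suc: "qdiff p (Suc m) y g = qdiff p m y (\<lambda>j. g j - p ^ m * y * g (Suc j))"
proof -
  define f where "f j = (-1) ^ j * p ^ (j choose 2) * y ^ j * qbin p m j * g j" for j
  have *: "(-1) ^ Suc j * p ^ (Suc j choose 2) * y ^ Suc j * qbin p (Suc m) (Suc j) * g (Suc j)
     = f (Suc j) - (-1) ^ j * p ^ (j choose 2) * y ^ j * qbin p m j * (p ^ m * y * g (Suc j))"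
    if "j \<le> m" for j
  proof -
    have "p ^ m = p ^ j * p ^ (m - j)" using that by (simp flip: power_add)
    then show ?thesis
      by (simp add: f_def Suc_choose_two power_add algebra_simps)
  qed
  have "qdiff p (Suc m) y g = g 0 + (\<Sum>j\<le>m. f (Suc j)
     - (-1) ^ j * p ^ (j choose 2) * y ^ j * qbin p m j * (p ^ m * y * g (Suc j)))"
    unfolding qdiff_def by (subst sum.atMost_Suc_shift) (use * in \<open>simp add: numeral_2_eq_2\<close>)
  also have "\<dots> = g 0 + (\<Sum>j\<le>m. f (Suc j))
     - (\<Sum>j\<le>m. (-1) ^ j * p ^ (j choose 2) * y ^ j * qbin p m j * (p ^ m * y * g (Suc j)))"
    by (simp add: sum_subtractf)
  also have "g 0 + (\<Sum>j\<le>m. f (Suc j)) = (\<Sum>j\<le>Suc m. f j)"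
    by (subst sum.atMost_Suc_shift) (simp add: f_def numeral_2_eq_2)
  also have "\<dots> = (\<Sum>j\<le>m. f j)"
    by (simp add: f_def qbin_eq_0)
  finally show ?thesis
    by (simp add: qdiff_def f_def sum_subtractf right_diff_distrib)
qed

lemma qdiff_0 [simp]: "qdiff p 0 y g = g 0"
  by (simp add: qdiff_def numeral_2_eq_2)

lemma qdiff_cmult: "qdiff p m y (\<lambda>j. c * g j) = c * qdiff p m y g"
  by (simp add: qdiff_def sum_distrib_left mult_ac)

lemma qdiff_diff: "qdiff p m y (\<lambda>j. f j - g j) = qdiff p m y f - qdiff p m y g"
  by (simp add: qdiff_def right_diff_distrib sum_subtractf)

lemma qdiff_add: "qdiff p m y (\<lambda>j. f j + g j) = qdiff p m y f + qdiff p m y g"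
  by (simp add: qdiff_def distrib_left sum.distrib)

text \<open>The q-binomial theorem: a geometric sequence is an eigenvector of the shift
  \<open>E\<close> with eigenvalue \<open>x\<close>.\<close>

lemma qdiff_power: "qdiff p m y (\<lambda>j. x ^ j) = (\<Prod>s<m. 1 - p ^ s * y * x)"
proof (induction m)
  case (Suc m)
  have "qdiff p (Suc m) y (\<lambda>j. x ^ j) = qdiff p m y (\<lambda>j. (1 - p ^ m * y * x) * x ^ j)"
    by (simp add: qdiff_Suc algebra_simps)
  then show ?case using Suc by (simp add: qdiff_cmult)
qed simp

text \<open>The factors of this q-difference are \<open>1 - p^(-e) E\<close> for \<open>e\<close>
  from \<open>t\<close> to \<open>t + m - 1\<close>. The weight \<open>(p ^ j) ^ t\<close> is
  matched to \<open>e = t\<close>: it leaves a plain difference of Gaussian binomials, which the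
  Pascal rule turns into the same expression with \<open>r - 1\<close> and \<open>t + 1\<close>. For
  \<open>r = 0\<close> the difference is 0.\<close>

lemma qdiff_qbin_in_Ints_aux:
  assumes "p \<in> \<int>" "p \<noteq> 0" "r \<le> Suc b"
  shows "qdiff p m (p / p ^ (t + m)) (\<lambda>j. (p ^ j) ^ t * qbin p (b + j) r) \<in> \<int>"
  using assms(3)
proof (induction m arbitrary: t r)
  case 0
  then show ?case using assms qbin_in_Ints by simp
next
  case (Suc m)
  have y: "p ^ m * (p / p ^ (t + Suc m)) = 1 / p ^ t"
    using assms by (simp add: power_add)
  show ?case
  proof (cases r)
    case 0
    have "(p ^ j) ^ t * qbin p (b + j) r - p ^ m * (p / p ^ (t + Suc m)) * ((p ^ Suc j) ^ t * qbin p (b + Suc j) r) = 0" for j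
      unfolding y using assms 0 by (simp add: field_simps power_mult_distrib)
    then have "qdiff p (Suc m) (p / p ^ (t + Suc m)) (\<lambda>j. (p ^ j) ^ t * qbin p (b + j) r)
       = qdiff p m (p / p ^ (t + Suc m)) (\<lambda>j. 0)"
      by (simp only: qdiff_Suc)
    then show ?thesis by (simp add: qdiff_def)
  next
    case (Suc r')
    have "(p ^ j) ^ t * qbin p (b + j) r - p ^ m * (p / p ^ (t + Suc m)) * ((p ^ Suc j) ^ t * qbin p (b + Suc j) r)
       = - (p ^ (b - r')) * ((p ^ j) ^ Suc t * qbin p (b + j) r')" for j
    proof -
      \<comment> \<open>Here \<open>r \<le> Suc b\<close> is used: it gives
        \<open>r' \<le> b\<close>, so the natural subtraction is exact and
        \<open>p ^ (b - r')\<close> is an integer independent of \<open>j\<close>.\<close>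
      have "b + j - r' = b - r' + j" using Suc Suc.prems by simp
      then show ?thesis
        unfolding y using assms Suc by (simp add: field_simps power_mult_distrib power_add)
    qed
    then have "qdiff p (Suc m) (p / p ^ (t + Suc m)) (\<lambda>j. (p ^ j) ^ t * qbin p (b + j) r)
       = - (p ^ (b - r')) * qdiff p m (p / p ^ (Suc t + m)) (\<lambda>j. (p ^ j) ^ Suc t * qbin p (b + j) r')"
      by (simp only: qdiff_Suc qdiff_cmult add_Suc_right add_Suc)
    moreover have "qdiff p m (p / p ^ (Suc t + m)) (\<lambda>j. (p ^ j) ^ Suc t * qbin p (b + j) r') \<in> \<int>"
      using Suc.IH[of r' "Suc t"] Suc Suc.prems by simp
    moreover have "- (p ^ (b - r')) \<in> \<int>"
      using assms by (intro Ints_minus Ints_power)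
    ultimately show ?thesis by (simp only: Ints_mult)
  qed
qed

text \<open>
  The terms contain negative powers of \<open>p\<close>, which cancel in the sum: the factors \<open>1 - p\<^sup>s E\<close> with
  \<open>s > 0\<close> are integral, and each of the remaining ones, \<open>1 - p\<^sup>-\<^sup>t E\<close>, lowers the index \<open>r\<close> of the
  Gaussian binomial and produces an additional factor \<open>p\<^sup>j\<close>.
\<close>
lemma qdiff_qbin_in_Ints:
  assumes "p \<in> \<int>" "p \<noteq> 0" "r \<le> Suc b" "i < m"
  shows "qdiff p m (1 / p ^ i) (\<lambda>j. qbin p (b + j) r) \<in> \<int>"
proof -
  \<comment> \<open>\<open>d\<close> counts the factors with a positive power of \<open>p\<close>.
    Peeling one off leads to \<open>b\<close> and \<open>Suc b\<close>; the remaining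
    \<open>Suc i\<close> factors are the auxiliary lemma with \<open>t = 0\<close>.\<close>
  have "r \<le> Suc b \<Longrightarrow> qdiff p (Suc i + d) (1 / p ^ i) (\<lambda>j. qbin p (b + j) r) \<in> \<int>" for d
  proof (induction d arbitrary: b)
    case 0
    have "p / p ^ Suc i = 1 / p ^ i" using assms by simp
    then show ?case using qdiff_qbin_in_Ints_aux[OF assms(1,2) 0, of "Suc i" 0] by simp
  next
    case (Suc d)
    have y: "p ^ (Suc i + d) * (1 / p ^ i) = p ^ Suc d"
      using assms by (simp add: power_add)
    have "qdiff p (Suc i + Suc d) (1 / p ^ i) (\<lambda>j. qbin p (b + j) r)
       = qdiff p (Suc i + d) (1 / p ^ i) (\<lambda>j. qbin p (b + j) r)
         - p ^ Suc d * qdiff p (Suc i + d) (1 / p ^ i) (\<lambda>j. qbin p (Suc b + j) r)"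
      using qdiff_Suc[of p "Suc i + d" "1 / p ^ i" "\<lambda>j. qbin p (b + j) r"]
      unfolding y qdiff_diff qdiff_cmult by simp
    moreover have "qdiff p (Suc i + d) (1 / p ^ i) (\<lambda>j. qbin p (b + j) r) \<in> \<int>"
      "qdiff p (Suc i + d) (1 / p ^ i) (\<lambda>j. qbin p (Suc b + j) r) \<in> \<int>"
      using Suc.IH[of b] Suc.IH[of "Suc b"] Suc.prems by simp_all
    ultimately show ?case
      using assms(1) by (simp only: Ints_diff Ints_mult Ints_power)
  qed
  from this[of "m - Suc i"] assms show ?thesis by simp
qed

section \<open>Partial fractions through q-differences\<close>

text \<open>The argument is a polynomial in \<open>p ^ j\<close> whose exponents lie between
  \<open>k\<close> and \<open>k + r\<close>, hence in \<open>1..n\<close>. The power with exponent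
  \<open>k\<close> is annihilated by the factor with \<open>s = n - k\<close>.\<close>

lemma qdiff_eq_0:
  assumes "p \<noteq> 0" "0 < k" "k + r \<le> n"
  shows "qdiff p n (1 / p ^ n) (\<lambda>j. (\<Prod>i=1..r. p ^ i * p ^ j - 1) * (p ^ j) ^ k) = 0"
  using assms(2,3)
proof (induction r arbitrary: k)
  case 0
  have "qdiff p n (1 / p ^ n) (\<lambda>j. (p ^ k) ^ j) = (\<Prod>s<n. 1 - p ^ s * (1 / p ^ n) * p ^ k)"
    by (rule qdiff_power)
  also have "\<dots> = 0"
  proof -
    have "n - k < n" "p ^ (n - k) * p ^ k = p ^ n"
      using 0 by (simp_all flip: power_add)
    then show ?thesis using assms by (intro prod_zero) (auto intro!: bexI[of _ "n - k"])
  qed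
  finally show ?case by (simp add: mult.commute flip: power_mult)
next
  case (Suc r)
  have "qdiff p n (1 / p ^ n) (\<lambda>j. (\<Prod>i=1..Suc r. p ^ i * p ^ j - 1) * (p ^ j) ^ k)
    = qdiff p n (1 / p ^ n) (\<lambda>j. p ^ Suc r * ((\<Prod>i=1..r. p ^ i * p ^ j - 1) * (p ^ j) ^ Suc k)
        - (\<Prod>i=1..r. p ^ i * p ^ j - 1) * (p ^ j) ^ k)"
    by (simp add: algebra_simps)
  also have "\<dots> = 0"
    unfolding qdiff_cmult qdiff_diff using Suc.IH[of k] Suc.IH[of "Suc k"] Suc.prems by simp
  finally show ?case .
qed

text \<open>Consecutive denominators share all but one linear factor. Applying
  \<open>1 - p^(-(t+1)) E\<close> therefore puts both fractions over the product with
  \<open>Suc t\<close> in place of \<open>t\<close>; \<open>z\<close> cancels in the numerator,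
  leaving \<open>p ^ Suc t - 1\<close> and one more power of \<open>p ^ j\<close>.\<close>

lemma qdiff_pole_aux:
  assumes "p \<noteq> 0" "\<And>j. p ^ j \<noteq> z"
  shows "qdiff p m (1 / p ^ (t + m)) (\<lambda>j. (p ^ j) ^ Suc t / (\<Prod>l\<le>t. p ^ (j + l) - z))
    = (\<Prod>i=Suc t..t+m. p ^ i - 1) / (\<Prod>l\<le>t+m. p ^ l - z)"
proof (induction m arbitrary: t)
  case (Suc m)
  have y: "p ^ m * (1 / p ^ (t + Suc m)) = 1 / p ^ Suc t"
    using assms by (simp add: power_add)
  have step: "(p ^ j) ^ Suc t / (\<Prod>l\<le>t. p ^ (j + l) - z)
      - p ^ m * (1 / p ^ (t + Suc m)) * ((p ^ Suc j) ^ Suc t / (\<Prod>l\<le>t. p ^ (Suc j + l) - z))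
      = (p ^ Suc t - 1) * ((p ^ j) ^ Suc (Suc t) / (\<Prod>l\<le>Suc t. p ^ (j + l) - z))" for j
  proof -
    define A where "A = (\<Prod>l<t. p ^ (Suc j + l) - z)"
    have A: "A \<noteq> 0"
      unfolding A_def prod_zero_iff[OF finite_lessThan] using assms(2) by (meson right_minus_eq)
    have 1: "(\<Prod>l\<le>t. p ^ (j + l) - z) = (p ^ j - z) * A"
      by (simp add: A_def prod.atMost_shift del: prod.atMost_Suc)
    have 2: "(\<Prod>l\<le>t. p ^ (Suc j + l) - z) = A * (p ^ (Suc j + t) - z)"
      by (simp add: A_def flip: lessThan_Suc_atMost)
    have 3: "(\<Prod>l\<le>Suc t. p ^ (j + l) - z) = (p ^ j - z) * A * (p ^ (Suc j + t) - z)"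
      using 1 by simp
    have nz: "p ^ j - z \<noteq> 0" "p ^ (Suc j + t) - z \<noteq> 0"
      using assms(2) by (metis eq_iff_diff_eq_0)+
    define X Y where "X = p ^ j" and "Y = p ^ Suc t"
    have XY: "p ^ (Suc j + t) = X * Y" by (simp add: X_def Y_def power_add)
    have p: "(p ^ Suc j) ^ Suc t = Y * X ^ Suc t"
      unfolding X_def Y_def by (simp add: power_mult_distrib)
    have Y: "Y \<noteq> 0" using assms by (simp add: Y_def)
    show ?thesis
      unfolding y 1 2 3 p unfolding XY X_def[symmetric] Y_def[symmetric]
      using A nz Y unfolding XY X_def[symmetric]
      by (simp add: divide_simps) (simp add: algebra_simps)
  qed
  have "qdiff p (Suc m) (1 / p ^ (t + Suc m)) (\<lambda>j. (p ^ j) ^ Suc t / (\<Prod>l\<le>t. p ^ (j + l) - z))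
     = (p ^ Suc t - 1) * ((\<Prod>i=Suc (Suc t)..Suc t + m. p ^ i - 1) / (\<Prod>l\<le>Suc t + m. p ^ l - z))"
    using Suc[of "Suc t"] unfolding qdiff_Suc step qdiff_cmult by (simp only: add_Suc_right add_Suc)
  also have "\<dots> = (\<Prod>i=Suc t..t + Suc m. p ^ i - 1) / (\<Prod>l\<le>t + Suc m. p ^ l - z)"
    by (simp add: prod.atLeast_Suc_atMost[of "Suc t"] del: prod.cl_ivl_Suc prod.atMost_Suc)
  finally show ?case .
qed auto

lemma qdiff_pole:
  assumes "p \<noteq> 0" "\<And>j. p ^ j \<noteq> z"
  shows "qdiff p n (1 / p ^ n) (\<lambda>j. p ^ j / (p ^ j - z))
    = (\<Prod>i=1..n. p ^ i - 1) / (\<Prod>l\<le>n. p ^ l - z)"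
  using qdiff_pole_aux[OF assms, of n 0] by simp

text \<open>Write \<open>p ^ Suc r * p ^ j - 1\<close> as \<open>p ^ Suc r * (p ^ j - z)\<close>
  plus \<open>p ^ Suc r * z - 1\<close>. The first part cancels the pole and is annihilated by
  \<open>qdiff_eq_0\<close>; the second is constant in \<open>j\<close>. In effect
  \<open>p ^ j\<close> is replaced by \<open>z\<close> in each factor.\<close>

lemma qdiff_prod_pole:
  assumes "p \<noteq> 0" "\<And>j. p ^ j \<noteq> z" "r \<le> n"
  shows "qdiff p n (1 / p ^ n) (\<lambda>j. (\<Prod>i=1..r. p ^ i * p ^ j - 1) * (p ^ j / (p ^ j - z)))
    = (\<Prod>i=1..r. p ^ i * z - 1) * (\<Prod>i=1..n. p ^ i - 1) / (\<Prod>l\<le>n. p ^ l - z)"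
  using assms(3)
proof (induction r)
  case 0
  then show ?case using qdiff_pole[OF assms(1,2)] by simp
next
  case (Suc r)
  have "(\<Prod>i=1..Suc r. p ^ i * p ^ j - 1) * (p ^ j / (p ^ j - z))
    = p ^ Suc r * ((\<Prod>i=1..r. p ^ i * p ^ j - 1) * (p ^ j) ^ 1)
      + (p ^ Suc r * z - 1) * ((\<Prod>i=1..r. p ^ i * p ^ j - 1) * (p ^ j / (p ^ j - z)))" for j
  proof -
    have nz: "p ^ j - z \<noteq> 0" using assms(2) by (metis eq_iff_diff_eq_0)
    then have *: "(p ^ Suc r * p ^ j - 1) * (p ^ j / (p ^ j - z))
      = p ^ Suc r * p ^ j + (p ^ Suc r * z - 1) * (p ^ j / (p ^ j - z))"
      by (simp add: divide_simps) (simp add: algebra_simps)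
    have "(\<Prod>i=1..Suc r. p ^ i * p ^ j - 1) * (p ^ j / (p ^ j - z)) =
       (\<Prod>i=1..r. p ^ i * p ^ j - 1) * ((p ^ Suc r * p ^ j - 1) * (p ^ j / (p ^ j - z)))"
      by simp
    then show ?thesis unfolding * by (simp add: algebra_simps)
  qed
  then have "qdiff p n (1 / p ^ n) (\<lambda>j. (\<Prod>i=1..Suc r. p ^ i * p ^ j - 1) * (p ^ j / (p ^ j - z)))
    = (p ^ Suc r * z - 1) * qdiff p n (1 / p ^ n) (\<lambda>j. (\<Prod>i=1..r. p ^ i * p ^ j - 1) * (p ^ j / (p ^ j - z)))"
    using qdiff_eq_0[OF assms(1), of 1 r n] Suc.prems
    by (simp only: qdiff_add qdiff_cmult)
  also have "\<dots> = (p ^ Suc r * z - 1) * ((\<Prod>i=1..r. p ^ i * z - 1) * (\<Prod>i=1..n. p ^ i - 1) / (\<Prod>l\<le>n. p ^ l - z))"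
    using Suc by simp
  finally show ?case by simp
qed

text \<open>The partial fraction expansion of \<open>G_n(z)\<close>. The Gaussian binomial is, up to
  the constant \<open>F\<close>, the numerator of \<open>G_n\<close> at
  \<open>z = p ^ j\<close>.\<close>

lemma qdiff_qbin_pole:
  assumes "\<bar>p\<bar> > 1" "\<And>j. p ^ j \<noteq> z"
  shows "qdiff p n (1 / p ^ n) (\<lambda>j. qbin p (n + j) n * (p ^ j / (p ^ j - z)))
    = (\<Prod>i=1..n. p ^ i * z - 1) / (\<Prod>l\<le>n. p ^ l - z)"
proof -
  define F where "F = (\<Prod>i=1..n. p ^ i - 1)"
  have "p ^ i \<noteq> 1" if "i \<ge> 1" for i
    using assms(1) that by (metis abs_1 less_irrefl less_le_trans one_less_power power_abs zero_less_one)
  then have F: "F \<noteq> 0" by (auto simp: F_def)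
  have "qbin p (n + j) n * F = (\<Prod>i=1..n. p ^ i * p ^ j - 1)" for j
    using qbin_mult_prod[of n "n + j" p] by (simp add: F_def power_add mult.commute)
  then have "qbin p (n + j) n = inverse F * (\<Prod>i=1..n. p ^ i * p ^ j - 1)" for j
    using F by (simp add: field_simps)
  then have "qdiff p n (1 / p ^ n) (\<lambda>j. qbin p (n + j) n * (p ^ j / (p ^ j - z)))
    = inverse F * qdiff p n (1 / p ^ n) (\<lambda>j. (\<Prod>i=1..n. p ^ i * p ^ j - 1) * (p ^ j / (p ^ j - z)))"
    by (simp only: mult.assoc qdiff_cmult)
  then show ?thesis
    using qdiff_prod_pole[of p z n n] assms F by (auto simp: F_def)
qed

section \<open>Elementary bounds and the Lambert series\<close>

lemma power_abs_ge:
  fixes p :: real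
  assumes "\<bar>p\<bar> \<ge> 2" "k > 0"
  shows "2 \<le> \<bar>p\<bar> ^ k"
  using assms self_le_power[of "\<bar>p\<bar>" k] by simp

lemma abs_power_minus_1_bounds:
  fixes p :: real
  assumes "\<bar>p\<bar> \<ge> 2" "k > 0"
  shows "\<bar>p\<bar> ^ k \<le> 2 * \<bar>p ^ k - 1\<bar>" "\<bar>p ^ k - 1\<bar> \<le> 2 * \<bar>p\<bar> ^ k"
proof -
  have "2 \<le> \<bar>p ^ k\<bar>" using power_abs_ge[OF assms] by (simp only: power_abs)
  moreover have "\<bar>X\<bar> \<le> 2 * \<bar>X - 1\<bar> \<and> \<bar>X - 1\<bar> \<le> 2 * \<bar>X\<bar>" if "2 \<le> \<bar>X\<bar>" for X :: real
    using that by (auto simp: abs_if split: if_splits)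
  ultimately have "\<bar>p ^ k\<bar> \<le> 2 * \<bar>p ^ k - 1\<bar> \<and> \<bar>p ^ k - 1\<bar> \<le> 2 * \<bar>p ^ k\<bar>"
    by blast
  then show "\<bar>p\<bar> ^ k \<le> 2 * \<bar>p ^ k - 1\<bar>" "\<bar>p ^ k - 1\<bar> \<le> 2 * \<bar>p\<bar> ^ k"
    by (simp_all only: power_abs)
qed

lemma power_neq_pm1:
  fixes p :: real
  assumes "\<bar>p\<bar> \<ge> 2" "k > 0"
  shows "p ^ k \<noteq> 1" "p ^ k \<noteq> -1" "p ^ k - 1 \<noteq> 0" "p ^ k + 1 \<noteq> 0"
  using power_abs_ge[OF assms] by (auto simp: power_abs[symmetric] add_eq_0_iff2)

definition lambert_term :: "real \<Rightarrow> nat \<Rightarrow> real" where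
  "lambert_term p t = (-1) ^ Suc t / (p ^ Suc t - 1)"

lemma lambert_term_summable:
  assumes "\<bar>p\<bar> \<ge> 2"
  shows "summable (lambert_term p)"
proof (rule summable_comparison_test')
  show "summable (\<lambda>t. 2 * (1 / 2 :: real) ^ Suc t)"
    by (intro summable_mult) (simp add: summable_Suc_iff)
  fix t :: nat
  have "2 ^ Suc t \<le> \<bar>p\<bar> ^ Suc t" using assms by (intro power_mono) auto
  also have "\<dots> \<le> 2 * \<bar>p ^ Suc t - 1\<bar>" using abs_power_minus_1_bounds[OF assms, of "Suc t"] by simp
  finally have "2 ^ Suc t \<le> 2 * \<bar>p ^ Suc t - 1\<bar>" .
  then have "1 / \<bar>p ^ Suc t - 1\<bar> \<le> 2 / 2 ^ Suc t"
    using power_neq_pm1[OF assms, of "Suc t"] by (simp add: field_simps)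
  then show "norm (lambert_term p t) \<le> 2 * (1 / 2) ^ Suc t"
    unfolding lambert_term_def by (simp add: power_abs power_divide del: power_Suc)
qed

text \<open>For large \<open>P\<close> this is the expansion of \<open>1 / (P - 1)\<close> in powers
  of \<open>1 / P\<close> without its first \<open>n - 1\<close> terms.\<close>

lemma sum_inverse_powers:
  fixes P :: real
  assumes "P \<noteq> 0" "P \<noteq> 1" "n > 0"
  shows "1 / (P - 1) - (\<Sum>i=1..<n. 1 / P ^ i) = P / (P ^ n * (P - 1))"
  using assms(3)
proof (induction n rule: nat_induct_non_zero)
  case 1
  then show ?case using assms by simp
next
  case (Suc n)
  have "1 / (P - 1) - (\<Sum>i=1..<Suc n. 1 / P ^ i) = P / (P ^ n * (P - 1)) - 1 / P ^ n"
    using Suc by simp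
  also have "\<dots> = P / (P ^ Suc n * (P - 1))"
    using assms by (simp add: divide_simps)
  finally show ?case .
qed

text \<open>With \<open>P = p ^ Suc (s + j)\<close> the summand is, up to sign,
  \<open>p^(n j) P / (P^n (P - 1))\<close>. By \<open>sum_inverse_powers\<close> it splits into a
  Lambert term, which sums to a tail of the series, and powers of \<open>1 / P\<close>, which sum as
  geometric series with ratio \<open>- 1 / p ^ i\<close>.\<close>

lemma inner_sums:
  assumes "\<bar>p\<bar> \<ge> 2" "n > 0"
  shows "(\<lambda>s. (-1) ^ Suc s / p ^ (n * Suc s) * (p ^ j / (p ^ j - 1 / p ^ Suc s))) sums
    ((-1) ^ j * (p ^ n) ^ j * (suminf (lambert_term p) - (\<Sum>t<j. lambert_term p t)
       + (\<Sum>i=1..<n. (-1) ^ j / (p ^ i) ^ j / (p ^ i + 1))))"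
proof -
  have "(\<lambda>s. lambert_term p (s + j)) sums (suminf (lambert_term p) - (\<Sum>t<j. lambert_term p t))"
    using lambert_term_summable[OF assms(1)] by (intro sums_split_initial_segment summable_sums)
  moreover have "(\<lambda>s. (\<Sum>i=1..<n. (- 1 / p ^ i) ^ Suc (s + j))) sums
      (\<Sum>i=1..<n. - ((-1) ^ j / (p ^ i) ^ j / (p ^ i + 1)))"
  proof (rule sums_sum)
    fix i assume "i \<in> {1..<n}"
    then have i: "i > 0" by simp
    have p: "2 \<le> \<bar>p ^ i\<bar>" using power_abs_ge[OF assms(1) i] by (simp add: power_abs)
    then have "norm (- 1 / p ^ i) < 1" by (simp add: divide_simps)
    then have "(\<lambda>s. (- 1 / p ^ i) ^ Suc j * (- 1 / p ^ i) ^ s) sums ((- 1 / p ^ i) ^ Suc j * (1 / (1 - (- 1 / p ^ i))))"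
      by (intro sums_mult geometric_sums)
    moreover have "(- 1 / p ^ i) ^ Suc j * (1 / (1 - (- 1 / p ^ i))) = - ((-1) ^ j / (p ^ i) ^ j / (p ^ i + 1))"
    proof -
      define X where "X = p ^ i"
      have "X \<noteq> 0" "X + 1 \<noteq> 0" using p unfolding X_def[symmetric] by auto
      then have "(1 / (1 - (- 1 / X))) = X / (X + 1)" by (simp add: field_simps)
      moreover have "(- 1 / X) ^ Suc j = (- 1) ^ Suc j / X ^ Suc j" by (rule power_divide)
      ultimately show ?thesis using \<open>X \<noteq> 0\<close> unfolding X_def[symmetric] by simp
    qed
    moreover have "(- 1 / p ^ i) ^ Suc j * (- 1 / p ^ i) ^ s = (- 1 / p ^ i) ^ Suc (s + j)" for s
      by (metis add.commute add_Suc power_add)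
    ultimately show "(\<lambda>s. (- 1 / p ^ i) ^ Suc (s + j)) sums - ((-1) ^ j / (p ^ i) ^ j / (p ^ i + 1))"
      by (simp only:)
  qed
  ultimately have "(\<lambda>s. (-1) ^ j * (p ^ n) ^ j * (lambert_term p (s + j) - (\<Sum>i=1..<n. (- 1 / p ^ i) ^ Suc (s + j)))) sums
     ((-1) ^ j * (p ^ n) ^ j * (suminf (lambert_term p) - (\<Sum>t<j. lambert_term p t) -
      (\<Sum>i=1..<n. - ((-1) ^ j / (p ^ i) ^ j / (p ^ i + 1)))))"
    by (intro sums_mult sums_diff)
  moreover have "(-1) ^ j * (p ^ n) ^ j * (lambert_term p (s + j) - (\<Sum>i=1..<n. (- 1 / p ^ i) ^ Suc (s + j)))
     = (-1) ^ Suc s / p ^ (n * Suc s) * (p ^ j / (p ^ j - 1 / p ^ Suc s))" for s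
  proof -
    define P where "P = p ^ Suc (s + j)"
    have P: "P \<noteq> 0" "P \<noteq> 1" "p \<noteq> 0"
      using power_neq_pm1[OF assms(1), of "Suc (s + j)"] assms by (auto simp: P_def)
    have e: "(- 1 / p ^ i) ^ Suc (s + j) = (-1) ^ Suc (s + j) * (1 / P ^ i)" for i
    proof -
      have "(p ^ i) ^ Suc (s + j) = P ^ i" unfolding P_def by (metis mult.commute power_mult)
      then show ?thesis unfolding power_divide by (simp only: times_divide_eq_right mult_1_right)
    qed
    have "lambert_term p (s + j) - (\<Sum>i=1..<n. (- 1 / p ^ i) ^ Suc (s + j))
       = (-1) ^ Suc (s + j) * (1 / (P - 1) - (\<Sum>i=1..<n. 1 / P ^ i))"
      unfolding lambert_term_def e P_def[symmetric] sum_distrib_left[symmetric] right_diff_distrib by simp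
    also have "\<dots> = (-1) ^ Suc (s + j) * (P / (P ^ n * (P - 1)))"
      using sum_inverse_powers[OF P(1,2) assms(2)] by simp
    finally have 1: "lambert_term p (s + j) - (\<Sum>i=1..<n. (- 1 / p ^ i) ^ Suc (s + j)) = \<dots>" .
    have "P ^ n = (p ^ n) ^ j * p ^ (n * Suc s)"
      unfolding P_def power_mult[symmetric] power_add[symmetric] by (simp only: algebra_simps add_Suc_right mult_Suc_right)
    moreover have "p ^ j / (p ^ j - 1 / p ^ Suc s) = P / (P - 1)"
    proof -
      have "P = p ^ j * p ^ Suc s" by (simp add: P_def power_add)
      moreover have "p ^ j - 1 / p ^ Suc s = (p ^ j * p ^ Suc s - 1) / p ^ Suc s"
        using P by (simp add: field_simps)
      ultimately show ?thesis by simp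
    qed
    moreover have "(-1) ^ j * (-1) ^ Suc (s + j) = ((-1) ^ Suc s :: real)"
      by (simp add: minus_one_power_iff)
    moreover have "a * c * (b * (P / (d * e * (P - 1)))) = (a * b) / e * (P / (P - 1))"
      if "c = d" "d \<noteq> 0" for a b c d e :: real
      using that by (simp add: divide_simps)
    ultimately show ?thesis
      unfolding 1 using P by simp
  qed
  ultimately show ?thesis by (simp add: sum_negf)
qed

section \<open>The linear forms in 1 and Ln_q(2)\<close>

text \<open>The weight of the pole at \<open>p ^ j\<close> after its sign and its power
  \<open>p^(-n j)\<close> have cancelled against \<open>(-1)^j p^(n j)\<close> from
  \<open>inner_sums\<close>.\<close>

definition approx_coeff :: "real \<Rightarrow> nat \<Rightarrow> nat \<Rightarrow> real" where
  "approx_coeff p n j = p ^ (j choose 2) * qbin p n j * qbin p (n + j) n"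

definition approx_den :: "real \<Rightarrow> nat \<Rightarrow> real" where
  "approx_den p n = (\<Sum>j\<le>n. approx_coeff p n j)"

text \<open>The geometric parts are grouped by \<open>i\<close> rather than by \<open>j\<close>: the
  sum over \<open>j\<close> is then a q-difference with parameter \<open>1 / p ^ i\<close>, which is
  an integer for integral \<open>p\<close> although its terms need not be.\<close>

definition approx_num :: "real \<Rightarrow> nat \<Rightarrow> real" where
  "approx_num p n = (\<Sum>j\<le>n. approx_coeff p n j * (\<Sum>t<j. lambert_term p t))
     - (\<Sum>i=1..<n. qdiff p n (1 / p ^ i) (\<lambda>j. qbin p (n + j) n) / (p ^ i + 1))"

text \<open>The summand \<open>(-1)^s p^(-n s) G_n(p^(-s))\<close> of the remainder series.\<close>

definition remainder_term :: "real \<Rightarrow> nat \<Rightarrow> nat \<Rightarrow> real" where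
  "remainder_term p n s = (-1) ^ s / p ^ (n * s) *
     ((\<Prod>i=1..n. p ^ i / p ^ s - 1) / (\<Prod>l\<le>n. p ^ l - 1 / p ^ s))"

text \<open>Each summand is expanded in partial fractions, and the finite sum over the poles
  \<open>p ^ j\<close> is exchanged with the series over \<open>s\<close>, which
  \<open>inner_sums\<close> evaluates pole by pole.\<close>

lemma remainder_sums:
  assumes p: "\<bar>p\<bar> \<ge> 2" and "n > 0"
  shows "(\<lambda>s. remainder_term p n (Suc s)) sums (approx_den p n * suminf (lambert_term p) - approx_num p n)"
proof -
  have p0: "p \<noteq> 0" using p by auto
  define w where "w j = (-1) ^ j * p ^ (j choose 2) * (1 / p ^ n) ^ j * qbin p n j * qbin p (n + j) n" for j
  define L where "L j = (-1) ^ j * (p ^ n) ^ j * (suminf (lambert_term p) - (\<Sum>t<j. lambert_term p t)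
       + (\<Sum>i=1..<n. (-1) ^ j / (p ^ i) ^ j / (p ^ i + 1)))" for j
  have "(\<lambda>s. \<Sum>j\<le>n. w j * ((-1) ^ Suc s / p ^ (n * Suc s) * (p ^ j / (p ^ j - 1 / p ^ Suc s)))) sums (\<Sum>j\<le>n. w j * L j)"
    unfolding L_def using inner_sums[OF assms] by (intro sums_sum sums_mult)
  moreover have "(\<Sum>j\<le>n. w j * ((-1) ^ Suc s / p ^ (n * Suc s) * (p ^ j / (p ^ j - 1 / p ^ Suc s))))
     = remainder_term p n (Suc s)" for s
  proof -
    have "p ^ j \<noteq> 1 / p ^ Suc s" for j
      using power_neq_pm1(1)[OF p, of "j + Suc s"] p0 unfolding power_add by (simp add: eq_divide_eq)
    then have "qdiff p n (1 / p ^ n) (\<lambda>j. qbin p (n + j) n * (p ^ j / (p ^ j - 1 / p ^ Suc s)))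
      = (\<Prod>i=1..n. p ^ i / p ^ Suc s - 1) / (\<Prod>l\<le>n. p ^ l - 1 / p ^ Suc s)"
      using qdiff_qbin_pole[of p "1 / p ^ Suc s" n] p by simp
    moreover have "(\<Sum>j\<le>n. w j * ((-1) ^ Suc s / p ^ (n * Suc s) * (p ^ j / (p ^ j - 1 / p ^ Suc s))))
      = (-1) ^ Suc s / p ^ (n * Suc s) * qdiff p n (1 / p ^ n) (\<lambda>j. qbin p (n + j) n * (p ^ j / (p ^ j - 1 / p ^ Suc s)))"
      unfolding qdiff_def sum_distrib_left w_def by (rule sum.cong) (simp_all only: mult_ac)
    ultimately show ?thesis by (simp only: remainder_term_def)
  qed
  moreover have "(\<Sum>j\<le>n. w j * L j) = approx_den p n * suminf (lambert_term p) - approx_num p n"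
  proof -
    have "w j * L j = approx_coeff p n j * suminf (lambert_term p)
       - approx_coeff p n j * (\<Sum>t<j. lambert_term p t)
       + (\<Sum>i=1..<n. (-1) ^ j * p ^ (j choose 2) * (1 / p ^ i) ^ j * qbin p n j * qbin p (n + j) n / (p ^ i + 1))" for j
    proof -
      have "(1 / p ^ n) ^ j * (p ^ n) ^ j = 1"
        using p0 by (simp flip: power_mult_distrib)
      moreover have "(-1) ^ j * (-1) ^ j = (1 :: real)"
        by (simp flip: power_mult_distrib)
      moreover have "w j * ((-1) ^ j * (p ^ n) ^ j) = approx_coeff p n j * (((-1) ^ j * (-1) ^ j) * ((1 / p ^ n) ^ j * (p ^ n) ^ j))"
        unfolding w_def approx_coeff_def by (simp only: mult_ac)
      ultimately have *: "w j * ((-1) ^ j * (p ^ n) ^ j) = approx_coeff p n j" by simp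
      have "w j * L j = approx_coeff p n j * (suminf (lambert_term p) - (\<Sum>t<j. lambert_term p t)
       + (\<Sum>i=1..<n. (-1) ^ j / (p ^ i) ^ j / (p ^ i + 1)))"
        unfolding L_def *[symmetric] by (simp only: mult.assoc)
      moreover have "approx_coeff p n j * (\<Sum>i=1..<n. (-1) ^ j / (p ^ i) ^ j / (p ^ i + 1))
        = (\<Sum>i=1..<n. (-1) ^ j * p ^ (j choose 2) * (1 / p ^ i) ^ j * qbin p n j * qbin p (n + j) n / (p ^ i + 1))"
        unfolding sum_distrib_left by (rule sum.cong) (simp_all add: approx_coeff_def power_divide)
      ultimately show ?thesis
        by (simp only: distrib_left right_diff_distrib)
    qed
    then have "(\<Sum>j\<le>n. w j * L j) = (\<Sum>j\<le>n. approx_coeff p n j * suminf (lambert_term p))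
       - (\<Sum>j\<le>n. approx_coeff p n j * (\<Sum>t<j. lambert_term p t))
       + (\<Sum>j\<le>n. \<Sum>i=1..<n. (-1) ^ j * p ^ (j choose 2) * (1 / p ^ i) ^ j * qbin p n j * qbin p (n + j) n / (p ^ i + 1))"
      by (simp add: sum.distrib sum_subtractf)
    also have "(\<Sum>j\<le>n. \<Sum>i=1..<n. (-1) ^ j * p ^ (j choose 2) * (1 / p ^ i) ^ j * qbin p n j * qbin p (n + j) n / (p ^ i + 1))
       = (\<Sum>i=1..<n. qdiff p n (1 / p ^ i) (\<lambda>j. qbin p (n + j) n) / (p ^ i + 1))"
      unfolding qdiff_def by (subst sum.swap) (simp add: sum_divide_distrib)
    finally show ?thesis
      by (simp add: approx_den_def approx_num_def sum_distrib_right)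
  qed
  ultimately show ?thesis by simp
qed

section \<open>Clearing the denominators\<close>

text \<open>The factor \<open>q ^ (2 * j) - 1\<close> covers both \<open>q ^ j - 1\<close> and
  \<open>q ^ j + 1\<close>. The upper half of the indices keeps the degree in \<open>q\<close> at
  \<open>3m^2 + m\<close>; all \<open>j\<close> up to \<open>2m\<close> would give
  \<open>4m^2 + 2m\<close>.\<close>

definition common_den :: "int \<Rightarrow> nat \<Rightarrow> int" where
  "common_den q m = (\<Prod>j\<in>{m<..2*m}. q ^ (2 * j) - 1)"

lemma power_minus_1_dvd: "q ^ a - 1 dvd q ^ (a * b) - (1 :: int)"
  using power_diff_1_eq[of "q ^ a" b] by (auto simp: power_mult)

text \<open>Doubling \<open>k\<close> repeatedly leads into the interval \<open>(m, 2m]\<close>.\<close>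
lemma power_dvd_common_den:
  assumes "0 < k" "k \<le> 2 * m"
  shows "q ^ (2 * k) - 1 dvd common_den q m"
  using assms
proof (induction "2 * m - k" arbitrary: k rule: less_induct)
  case less
  show ?case
  proof (cases "m < k")
    case True
    then show ?thesis using less.prems unfolding common_den_def
      by (intro dvd_prodI) auto
  next
    case False
    then have "q ^ (2 * (2 * k)) - 1 dvd common_den q m"
      using less.prems by (intro less.hyps) auto
    then show ?thesis
      using power_minus_1_dvd[of q "2 * k" 2] dvd_trans by (metis mult.assoc mult.commute)
  qed
qed

lemma common_den_dvd:
  assumes "0 < k" "k \<le> 2 * m"
  shows "q ^ k - 1 dvd common_den q m" "q ^ k + 1 dvd common_den q m"
proof -
  have "q ^ (2 * k) - 1 = (q ^ k - 1) * (q ^ k + 1)"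
    by (simp only: mult_2 power_add) (simp add: algebra_simps)
  then show "q ^ k - 1 dvd common_den q m" "q ^ k + 1 dvd common_den q m"
    using power_dvd_common_den[OF assms, of q] by (auto intro: dvd_trans)
qed

lemma real_divide_in_Ints:
  assumes "d dvd (a :: int)"
  shows "real_of_int a / real_of_int d \<in> \<int>"
  using assms by (metis Ints_of_int real_of_int_div)

lemma approx_coeff_in_Ints: "p \<in> \<int> \<Longrightarrow> approx_coeff p n j \<in> \<int>"
  unfolding approx_coeff_def by (intro Ints_mult Ints_power qbin_in_Ints)

lemma approx_den_in_Ints: "p \<in> \<int> \<Longrightarrow> approx_den p n \<in> \<int>"
  unfolding approx_den_def by (intro Ints_sum approx_coeff_in_Ints)

lemma approx_num_in_Ints:
  assumes "q \<noteq> 0"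
  shows "of_int (common_den q m) * approx_num (of_int q) (2 * m) \<in> \<int>"
proof -
  let ?p = "real_of_int q" and ?D = "real_of_int (common_den q m)"
  have 1: "?D / (?p ^ k - 1) \<in> \<int>" "?D / (?p ^ k + 1) \<in> \<int>" if "0 < k" "k \<le> 2 * m" for k
    using real_divide_in_Ints[OF common_den_dvd(1)[OF that, of q]]
      real_divide_in_Ints[OF common_den_dvd(2)[OF that, of q]] by simp_all
  have "?D * approx_num ?p (2 * m) =
      (\<Sum>j\<le>2*m. approx_coeff ?p (2*m) j * (\<Sum>t<j. (-1) ^ Suc t * (?D / (?p ^ Suc t - 1))))
     - (\<Sum>i=1..<2*m. qdiff ?p (2*m) (1 / ?p ^ i) (\<lambda>j. qbin ?p (2*m + j) (2*m)) * (?D / (?p ^ i + 1)))"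
    unfolding approx_num_def lambert_term_def right_diff_distrib sum_distrib_left
    by (simp add: mult_ac)
  also have "\<dots> \<in> \<int>"
    using assms by (intro Ints_diff Ints_sum Ints_mult approx_coeff_in_Ints 1 qdiff_qbin_in_Ints Ints_power) auto
  finally show ?thesis .
qed

section \<open>Size of the remainder\<close>

lemma remainder_term_eq_0:
  assumes "p \<noteq> 0" "0 < s" "s \<le> n"
  shows "remainder_term p n s = 0"
proof -
  have "(\<Prod>i=1..n. p ^ i / p ^ s - 1) = 0"
    using assms by (intro prod_zero) (auto intro!: bexI[of _ s])
  then show ?thesis by (simp add: remainder_term_def)
qed

lemma one_minus_inverse_power_bounds:
  fixes p :: real
  assumes "\<bar>p\<bar> \<ge> 2" "k > 0"
  shows "1 / 2 \<le> \<bar>1 - 1 / p ^ k\<bar>" "\<bar>1 - 1 / p ^ k\<bar> \<le> 3 / 2"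
proof -
  have p: "2 \<le> \<bar>p ^ k\<bar>" using power_abs_ge[OF assms] by (simp only: power_abs)
  then have "\<bar>1 / p ^ k\<bar> \<le> 1 / 2" by (simp add: divide_simps)
  then show "1 / 2 \<le> \<bar>1 - 1 / p ^ k\<bar>" "\<bar>1 - 1 / p ^ k\<bar> \<le> 3 / 2" by linarith+
qed

text \<open>The first \<open>n\<close> terms vanish, hence the index \<open>Suc (k + n)\<close>.
  Extracting \<open>p ^ l\<close> from each factor of the denominator leaves only factors
  \<open>1 - p^(-i)\<close>, which are bounded above and away from 0.\<close>

lemma abs_remainder_term:
  assumes "p \<noteq> 0"
  shows "\<bar>remainder_term p n (Suc (k + n))\<bar> =
    (\<Prod>i<n. \<bar>1 - 1 / p ^ Suc (k + i)\<bar>) /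
      (\<bar>p\<bar> ^ (n * Suc (k + n) + (\<Sum>l\<le>n. l)) * (\<Prod>l<Suc n. \<bar>1 - 1 / p ^ Suc (k + n + l)\<bar>))"
proof -
  have "\<bar>\<Prod>i=1..n. p ^ i / p ^ Suc (k + n) - 1\<bar> = (\<Prod>i=1..n. \<bar>1 - 1 / p ^ (Suc (k + n) - i)\<bar>)"
    unfolding abs_prod
  proof (rule prod.cong)
    fix i assume "i \<in> {1..n}"
    then have "p ^ Suc (k + n) = p ^ i * p ^ (Suc (k + n) - i)"
      by (simp del: power_Suc flip: power_add)
    then show "\<bar>p ^ i / p ^ Suc (k + n) - 1\<bar> = \<bar>1 - 1 / p ^ (Suc (k + n) - i)\<bar>"
      using assms by simp
  qed simp
  also have "\<dots> = (\<Prod>i<n. \<bar>1 - 1 / p ^ Suc (k + i)\<bar>)"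
    by (rule prod.reindex_bij_witness[of _ "\<lambda>i. n - i" "\<lambda>i. n - i"]) (auto simp: Suc_diff_le)
  finally have 1: "\<bar>\<Prod>i=1..n. p ^ i / p ^ Suc (k + n) - 1\<bar> = \<dots>" .
  have "\<bar>\<Prod>l\<le>n. p ^ l - 1 / p ^ Suc (k + n)\<bar> = (\<Prod>l\<le>n. \<bar>p\<bar> ^ l * \<bar>1 - 1 / p ^ Suc (k + n + l)\<bar>)"
    unfolding abs_prod
  proof (rule prod.cong)
    fix l
    have "p ^ l - 1 / p ^ Suc (k + n) = p ^ l * (1 - 1 / p ^ Suc (k + n + l))"
      using assms by (simp add: field_simps power_add)
    then show "\<bar>p ^ l - 1 / p ^ Suc (k + n)\<bar> = \<bar>p\<bar> ^ l * \<bar>1 - 1 / p ^ Suc (k + n + l)\<bar>"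
      by (simp only: abs_mult power_abs)
  qed simp
  also have "\<dots> = \<bar>p\<bar> ^ (\<Sum>l\<le>n. l) * (\<Prod>l<Suc n. \<bar>1 - 1 / p ^ Suc (k + n + l)\<bar>)"
    by (simp only: prod.distrib power_sum lessThan_Suc_atMost)
  finally have 2: "\<bar>\<Prod>l\<le>n. p ^ l - 1 / p ^ Suc (k + n)\<bar> = \<dots>" .
  show ?thesis
    unfolding remainder_term_def abs_mult abs_divide 1 2
    by (simp add: abs_mult power_abs power_add mult_ac del: power_Suc)
qed

text \<open>Raising \<open>k\<close> by 1 shifts both products by one index, which exchanges one
  factor for another. All factors lie between 1/2 and 3/2, so each product changes by at most a
  factor 3, while the power of \<open>p\<close> gains \<open>\<bar>p\<bar> ^ n\<close>.\<close>

lemma remainder_term_ratio: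
  assumes p: "\<bar>p\<bar> \<ge> 2" and n: "n \<ge> 5"
  shows "\<bar>remainder_term p n (Suc (Suc k + n))\<bar> \<le> \<bar>remainder_term p n (Suc (k + n))\<bar> / 3"
proof -
  have p0: "p \<noteq> 0" using p by auto
  define a where "a s = \<bar>1 - 1 / p ^ Suc s\<bar>" for s
  have a: "1 / 2 \<le> a s" "a s \<le> 3 / 2" for s
    using one_minus_inverse_power_bounds[OF p, of "Suc s"] unfolding a_def by auto
  have a0: "a s > 0" for s using a(1)[of s] by linarith
  define A where "A k = (\<Prod>i<n. a (k + i))" for k
  define C where "C k = (\<Prod>l<Suc n. a (k + n + l))" for k
  have A: "A k > 0" and C: "C k > 0" for k
    using a0 by (auto simp: A_def C_def intro!: prod_pos mult_pos_pos)
  have "A (Suc k) * a k = (\<Prod>i<Suc n. a (k + i))"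
    unfolding A_def prod.lessThan_Suc_shift by (simp add: mult.commute)
  also have "\<dots> = A k * a (k + n)" by (simp add: A_def)
  finally have "A (Suc k) * a k = A k * a (k + n)" .
  moreover have "A (Suc k) * (1 / 2) \<le> A (Suc k) * a k"
    using A a by (intro mult_left_mono) (auto intro: less_imp_le)
  moreover have "A k * a (k + n) \<le> A k * (3 / 2)"
    using A a by (intro mult_left_mono) (auto intro: less_imp_le)
  ultimately have A3: "A (Suc k) \<le> 3 * A k" by linarith
  have "C (Suc k) * a (k + n) = (\<Prod>i<Suc (Suc n). a (k + n + i))"
    unfolding C_def prod.lessThan_Suc_shift[of _ "Suc n"] by (simp add: mult.commute)
  also have "\<dots> = C k * a (k + n + Suc n)" by (simp add: C_def)
  finally have "C (Suc k) * a (k + n) = C k * a (k + n + Suc n)" .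
  moreover have "C (Suc k) * a (k + n) \<le> C (Suc k) * (3 / 2)"
    using C a by (intro mult_left_mono) (auto intro: less_imp_le)
  moreover have "C k * (1 / 2) \<le> C k * a (k + n + Suc n)"
    using C a by (intro mult_left_mono) (auto intro: less_imp_le)
  ultimately have C3: "C k \<le> 3 * C (Suc k)" by linarith
  \<comment> \<open>A factor 3 is lost for \<open>A\<close> and another for \<open>C\<close>; 27
    leaves the ratio 1/3. \<open>n \<ge> 5\<close> gives \<open>2 ^ 5 = 32\<close>.\<close>
  have B: "27 \<le> \<bar>p\<bar> ^ n"
  proof -
    have "(2 :: real) ^ 5 \<le> 2 ^ n" using n by (intro power_increasing) auto
    also have "\<dots> \<le> \<bar>p\<bar> ^ n" using p by (intro power_mono) auto
    finally show ?thesis by simp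
  qed
  define E where "E = \<bar>p\<bar> ^ (n * Suc (k + n) + (\<Sum>l\<le>n. l))"
  have E: "E > 0" using p0 by (simp add: E_def)
  have eq: "\<bar>remainder_term p n (Suc (k + n))\<bar> = A k / (E * C k)"
    unfolding abs_remainder_term[OF p0] A_def C_def E_def a_def ..
  have E2: "\<bar>p\<bar> ^ (n * Suc (Suc k + n) + (\<Sum>l\<le>n. l)) = \<bar>p\<bar> ^ n * E"
    unfolding E_def power_add[symmetric] by (simp add: add_ac)
  have "\<bar>remainder_term p n (Suc (Suc k + n))\<bar> = A (Suc k) / (\<bar>p\<bar> ^ n * E * C (Suc k))"
    unfolding abs_remainder_term[OF p0] A_def C_def a_def E2 ..
  also have "\<dots> \<le> (3 * A k) / (27 * E * (C k / 3))"
    using A C A3 C3 B E by (intro frac_le mult_mono mult_nonneg_nonneg) (auto intro: less_imp_le)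
  also have "\<dots> = A k / (E * C k) / 3" by simp
  finally show ?thesis unfolding eq .
qed

lemma remainder_bounds:
  assumes p: "\<bar>p\<bar> \<ge> 2" and n: "n \<ge> 5"
    and R: "R = approx_den p n * suminf (lambert_term p) - approx_num p n"
  shows "\<bar>R\<bar> \<le> \<bar>p\<bar> ^ (2 * n + 2) / \<bar>p\<bar> ^ (n * Suc n + (\<Sum>l\<le>n. l))"
    and "1 / \<bar>p\<bar> ^ (n * Suc n + (\<Sum>l\<le>n. l) + 2 * n + 2) \<le> \<bar>R\<bar>"
proof -
  have p0: "p \<noteq> 0" using p by auto
  define u where "u k = remainder_term p n (Suc (k + n))" for k
  have "(\<lambda>s. remainder_term p n (Suc s)) sums R"
    unfolding R using remainder_sums[OF p] n by simp
  then have u: "u sums R"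
    unfolding u_def using sums_zero_iff_shift[of n "\<lambda>s. remainder_term p n (Suc s)" R]
      remainder_term_eq_0[OF p0, of "Suc _" n] by simp
  have uk: "\<bar>u k\<bar> \<le> \<bar>u 0\<bar> * (1 / 3) ^ k" for k
  proof (induction k)
    case (Suc k)
    then show ?case using remainder_term_ratio[OF p n, of k] unfolding u_def by simp
  qed simp
  \<comment> \<open>The tail is at most \<open>1/3 + 1/9 + ... = 1/2\<close> of the first nonzero
    term \<open>u 0\<close>, so \<open>R\<close> has the size of \<open>u 0\<close> and is nonzero
    whenever \<open>u 0\<close> is.\<close>
  have "(\<lambda>k. u (Suc k)) sums (R - u 0)" using u by (simp add: sums_Suc_iff)
  moreover have "(\<lambda>k. \<bar>u 0\<bar> * (1 / 3) ^ Suc k) sums (\<bar>u 0\<bar> * (1 / 2))"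
    using sums_mult[OF geometric_sums[of "1 / 3 :: real"], of "\<bar>u 0\<bar> / 3"] by simp
  moreover have "norm (u (Suc k)) \<le> \<bar>u 0\<bar> * (1 / 3) ^ Suc k" for k
    using uk[of "Suc k"] by simp
  ultimately have "norm (R - u 0) \<le> \<bar>u 0\<bar> * (1 / 2)"
    by (metis (no_types, lifting) norm_suminf_le sums_summable sums_unique)
  then have R2: "\<bar>u 0\<bar> / 2 \<le> \<bar>R\<bar>" "\<bar>R\<bar> \<le> 2 * \<bar>u 0\<bar>" unfolding real_norm_def by linarith+
  define a where "a s = \<bar>1 - 1 / p ^ Suc s\<bar>" for s
  have a: "1 / 2 \<le> a s" "a s \<le> 2" for s
    using one_minus_inverse_power_bounds[OF p, of "Suc s"] unfolding a_def by auto
  define A where "A = (\<Prod>i<n. a (0 + i))"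
  define C where "C = (\<Prod>l<Suc n. a (0 + n + l))"
  define E where "E = \<bar>p\<bar> ^ (n * Suc (0 + n) + (\<Sum>l\<le>n. l))"
  have E: "E > 0" using p0 by (simp add: E_def)
  have prod_bounds: "(1 / 2) ^ N \<le> (\<Prod>i<N. a (f i)) \<and> (\<Prod>i<N. a (f i)) \<le> 2 ^ N" for N and f :: "nat \<Rightarrow> nat"
    using prod_mono[of "{..<N}" "\<lambda>_. 1 / 2" "\<lambda>i. a (f i)"] prod_mono[of "{..<N}" "\<lambda>i. a (f i)" "\<lambda>_. 2"] a
    by (auto simp: a_def)
  have A: "(1 / 2) ^ n \<le> A" "A \<le> 2 ^ n" and C: "(1 / 2) ^ Suc n \<le> C" "C \<le> 2 ^ Suc n"
    using prod_bounds unfolding A_def C_def by blast+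
  have u0: "\<bar>u 0\<bar> = A / (E * C)"
    unfolding u_def abs_remainder_term[OF p0] A_def C_def E_def a_def ..
  \<comment> \<open>All constants are rounded to powers of 2 and collected in
    \<open>2 ^ (2 * n + 2)\<close>, which \<open>\<bar>p\<bar> ^ (2 * n + 2)\<close> absorbs: a loss
    only linear in the exponent.\<close>
  have pow_split: "(2 :: real) ^ (2 * n + 2) = 4 * (2 ^ n * 2 ^ n)"
    unfolding mult_2 power_add by simp
  have p2: "2 ^ N \<le> \<bar>p\<bar> ^ N" for N using p by (intro power_mono) auto
  have "\<bar>u 0\<bar> \<le> 2 ^ n / (E * (1 / 2) ^ Suc n)"
    unfolding u0 using A C E by (intro frac_le mult_mono) (auto intro: less_imp_le)
  then have "\<bar>R\<bar> \<le> 2 * (2 ^ n / (E * (1 / 2) ^ Suc n))" using R2 by linarith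
  also have "\<dots> = 2 ^ (2 * n + 2) / E"
    unfolding pow_split by (simp add: power_one_over)
  also have "\<dots> \<le> \<bar>p\<bar> ^ (2 * n + 2) / E"
    using p2[of "2 * n + 2"] E by (intro divide_right_mono) auto
  finally show "\<bar>R\<bar> \<le> \<bar>p\<bar> ^ (2 * n + 2) / \<bar>p\<bar> ^ (n * Suc n + (\<Sum>l\<le>n. l))"
    unfolding E_def by simp
  have C0: "C > 0" using C(1) by (rule less_le_trans[rotated]) simp
  have "(1 / 2) ^ n / (E * 2 ^ Suc n) \<le> \<bar>u 0\<bar>"
    unfolding u0 using A C E C0 by (intro frac_le mult_mono) (auto intro: less_imp_le order_trans[rotated])
  then have "(1 / 2) ^ n / (E * 2 ^ Suc n) / 2 \<le> \<bar>u 0\<bar> / 2"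
    by (rule divide_right_mono) simp
  also note R2(1)
  finally have "(1 / 2) ^ n / (E * 2 ^ Suc n) / 2 \<le> \<bar>R\<bar>" .
  moreover have "(1 / 2) ^ n / (E * 2 ^ Suc n) / 2 = 1 / (E * 2 ^ (2 * n + 2))"
    unfolding pow_split by (simp add: power_one_over)
  moreover have "1 / (E * \<bar>p\<bar> ^ (2 * n + 2)) \<le> 1 / (E * 2 ^ (2 * n + 2))"
    using p2[of "2 * n + 2"] E p0 by (intro divide_left_mono mult_left_mono mult_pos_pos zero_less_power) auto
  moreover have "\<bar>p\<bar> ^ (n * Suc n + (\<Sum>l\<le>n. l) + 2 * n + 2) = E * \<bar>p\<bar> ^ (2 * n + 2)"
    unfolding E_def power_add[symmetric] by (simp add: add_ac)
  ultimately show "1 / \<bar>p\<bar> ^ (n * Suc n + (\<Sum>l\<le>n. l) + 2 * n + 2) \<le> \<bar>R\<bar>"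
    by (metis order_trans)
qed

section \<open>Size of the coefficients and of the common denominator\<close>

text \<open>In the product formula each of the \<open>k\<close> quotients is at most
  \<open>4 \<bar>p\<bar>^(n-k)\<close>, and the 4 is bounded by
  \<open>\<bar>p\<bar>^2\<close>.\<close>

lemma abs_qbin_le:
  fixes p :: real
  assumes p: "\<bar>p\<bar> \<ge> 2" and "k \<le> n"
  shows "\<bar>qbin p n k\<bar> \<le> \<bar>p\<bar> ^ ((n - k + 2) * k)"
proof -
  define F where "F = (\<Prod>i=1..k. \<bar>p ^ i - 1\<bar>)"
  have F: "F > 0" unfolding F_def using power_neq_pm1[OF p] by (intro prod_pos) auto
  have "\<bar>qbin p n k\<bar> * F = (\<Prod>i=1..k. \<bar>p ^ (n - k + i) - 1\<bar>)"
    unfolding F_def abs_prod[symmetric] abs_mult[symmetric] qbin_mult_prod[OF assms(2)] ..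
  also have "\<dots> \<le> (\<Prod>i=1..k. \<bar>p\<bar> ^ (n - k + 2) * \<bar>p ^ i - 1\<bar>)"
  proof (rule prod_mono, safe)
    fix i assume "i \<in> {1..k}"
    then have i: "i > 0" by simp
    have "\<bar>p ^ (n - k + i) - 1\<bar> \<le> 2 * \<bar>p\<bar> ^ (n - k) * \<bar>p\<bar> ^ i"
      using abs_power_minus_1_bounds(2)[OF p, of "n - k + i"] i by (simp add: power_add)
    also have "\<dots> \<le> 2 * \<bar>p\<bar> ^ (n - k) * (2 * \<bar>p ^ i - 1\<bar>)"
      using abs_power_minus_1_bounds(1)[OF p i] by (intro mult_left_mono) auto
    also have "\<dots> = 2\<^sup>2 * \<bar>p\<bar> ^ (n - k) * \<bar>p ^ i - 1\<bar>" by simp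
    also have "\<dots> \<le> \<bar>p\<bar>\<^sup>2 * \<bar>p\<bar> ^ (n - k) * \<bar>p ^ i - 1\<bar>"
      using p by (intro mult_right_mono power_mono) auto
    also have "\<dots> = \<bar>p\<bar> ^ (n - k + 2) * \<bar>p ^ i - 1\<bar>" by (simp only: power_add mult_ac)
    finally show "\<bar>p ^ (n - k + i) - 1\<bar> \<le> \<bar>p\<bar> ^ (n - k + 2) * \<bar>p ^ i - 1\<bar>" .
  qed simp
  also have "\<dots> = \<bar>p\<bar> ^ ((n - k + 2) * k) * F"
    unfolding F_def power_mult by (simp only: prod.distrib prod_constant card_atLeastAtMost diff_Suc_1)
  finally show ?thesis using F by simp
qed

lemma abs_approx_coeff_le:
  assumes p: "\<bar>p\<bar> \<ge> 2" and "j \<le> 2 * m"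
  shows "\<bar>approx_coeff p (2 * m) j\<bar> \<le> \<bar>p\<bar> ^ (6 * m\<^sup>2 + 7 * m)"
proof -
  let ?n = "2 * m"
  have "\<bar>approx_coeff p ?n j\<bar> \<le> \<bar>p\<bar> ^ (j choose 2) * \<bar>p\<bar> ^ ((?n - j + 2) * j) * \<bar>p\<bar> ^ ((j + 2) * ?n)"
    unfolding approx_coeff_def abs_mult power_abs
    using abs_qbin_le[OF p assms(2)] abs_qbin_le[OF p, of ?n "?n + j"]
    by (intro mult_mono) auto
  also have "\<dots> = \<bar>p\<bar> ^ ((j choose 2) + (?n - j + 2) * j + (j + 2) * ?n)"
    by (simp only: power_add)
  also have "\<dots> \<le> \<bar>p\<bar> ^ (6 * m\<^sup>2 + 7 * m)"
  proof (rule power_increasing)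
    \<comment> \<open>With \<open>n = 2m\<close>, the leading part \<open>2nj - j^2/2\<close> of the
      exponent is largest at \<open>j = n\<close>. Substituting \<open>n = j + d\<close> makes the
      difference of the two sides below a polynomial in \<open>j\<close> and \<open>d\<close> with
      nonnegative coefficients.\<close>
    obtain d where d: "?n = j + d" using assms(2) le_Suc_ex by blast
    have "2 * ((j choose 2) + (?n - j + 2) * j + (j + 2) * ?n) \<le> 3 * ?n\<^sup>2 + 7 * ?n"
    proof -
      have "2 * (j choose 2) + j = j\<^sup>2"
        by (induction j) (auto simp: numeral_2_eq_2)
      then show ?thesis unfolding d by (simp add: power2_eq_square algebra_simps)
    qed
    then show "(j choose 2) + (?n - j + 2) * j + (j + 2) * ?n \<le> 6 * m\<^sup>2 + 7 * m"
      by (simp add: power2_eq_square)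
  qed (use p in auto)
  finally show ?thesis .
qed

lemma abs_approx_den_le:
  assumes p: "\<bar>p\<bar> \<ge> 2"
  shows "\<bar>approx_den p (2 * m)\<bar> \<le> \<bar>p\<bar> ^ (6 * m\<^sup>2 + 9 * m)"
proof -
  have "\<bar>approx_den p (2 * m)\<bar> \<le> (\<Sum>j\<le>2*m. \<bar>approx_coeff p (2 * m) j\<bar>)"
    unfolding approx_den_def by (rule sum_abs)
  also have "\<dots> \<le> (\<Sum>j\<le>2*m. \<bar>p\<bar> ^ (6 * m\<^sup>2 + 7 * m))"
    using abs_approx_coeff_le[OF p] by (intro sum_mono) auto
  also have "\<dots> = real (Suc (2 * m)) * \<bar>p\<bar> ^ (6 * m\<^sup>2 + 7 * m)" by simp
  also have "\<dots> \<le> \<bar>p\<bar> ^ (2 * m) * \<bar>p\<bar> ^ (6 * m\<^sup>2 + 7 * m)"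
  proof (rule mult_right_mono)
    have "Suc (2 * m) \<le> 2 ^ (2 * m)" by (simp add: Suc_leI)
    then have "real (Suc (2 * m)) \<le> 2 ^ (2 * m)" by (metis of_nat_le_iff of_nat_numeral of_nat_power)
    also have "\<dots> \<le> \<bar>p\<bar> ^ (2 * m)" using p by (intro power_mono) auto
    finally show "real (Suc (2 * m)) \<le> \<bar>p\<bar> ^ (2 * m)" .
  qed simp
  also have "\<dots> = \<bar>p\<bar> ^ (6 * m\<^sup>2 + 9 * m)" unfolding power_add[symmetric] by (simp add: add_ac)
  finally show ?thesis .
qed

text \<open>The exponents \<open>2 * j\<close> are even, so \<open>q\<close> may be replaced by its
  absolute value \<open>B\<close>. Dropping the \<open>- 1\<close> costs at most a factor
  \<open>B\<close> in each of the \<open>m\<close> factors.\<close>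

lemma common_den_bounds:
  assumes "\<bar>q\<bar> \<ge> 2"
  shows "\<bar>real_of_int q\<bar> ^ (3 * m\<^sup>2) \<le> real_of_int (common_den q m)"
    and "real_of_int (common_den q m) \<le> \<bar>real_of_int q\<bar> ^ (3 * m\<^sup>2 + m)"
proof -
  define B where "B = \<bar>real_of_int q\<bar>"
  have B: "B \<ge> 2" using assms unfolding B_def by linarith
  have D: "real_of_int (common_den q m) = (\<Prod>j\<in>{m<..2*m}. B ^ (2 * j) - 1)"
    unfolding common_den_def B_def by (simp add: power_mult)
  have sum: "(\<Sum>j\<in>{m<..2*m}. 2 * j) = 3 * m\<^sup>2 + m"
  proof -
    have s: "(\<Sum>j\<in>{..N}. 2 * j) = N * Suc N" for N :: nat by (induction N) auto
    have "{..2*m} = {..m} \<union> {m<..2*m}" by auto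
    then have "(\<Sum>j\<in>{..2*m}. 2 * j) = (\<Sum>j\<in>{..m}. 2 * j) + (\<Sum>j\<in>{m<..2*m}. 2 * j)"
      by (metis (no_types, lifting) finite_atMost finite_greaterThanAtMost ivl_disj_int_one(3) sum.union_disjoint)
    then show ?thesis unfolding s by (simp add: power2_eq_square)
  qed
  have "(\<Prod>j\<in>{m<..2*m}. B ^ (2 * j) - 1) \<le> (\<Prod>j\<in>{m<..2*m}. B ^ (2 * j))"
    using B by (intro prod_mono) (auto intro: one_le_power)
  also have "\<dots> = B ^ (3 * m\<^sup>2 + m)" unfolding sum[symmetric] power_sum ..
  finally show "real_of_int (common_den q m) \<le> \<bar>real_of_int q\<bar> ^ (3 * m\<^sup>2 + m)"
    unfolding D B_def .
  have "B ^ (3 * m\<^sup>2) * B ^ m = (\<Prod>j\<in>{m<..2*m}. B ^ (2 * j))"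
    unfolding power_add[symmetric] sum[symmetric] power_sum ..
  also have "\<dots> \<le> (\<Prod>j\<in>{m<..2*m}. B * (B ^ (2 * j) - 1))"
  proof (rule prod_mono, safe)
    fix j assume "j \<in> {m<..2*m}"
    then have "2 \<le> B ^ (2 * j)" using power_abs_ge[of B "2 * j"] B by simp
    then have "B ^ (2 * j) \<le> 2 * (B ^ (2 * j) - 1)" by simp
    also have "\<dots> \<le> B * (B ^ (2 * j) - 1)"
      using B \<open>2 \<le> B ^ (2 * j)\<close> by (intro mult_right_mono) auto
    finally show "B ^ (2 * j) \<le> B * (B ^ (2 * j) - 1)" .
  qed (use B in auto)
  also have "\<dots> = real_of_int (common_den q m) * B ^ m" unfolding D by (simp add: prod.distrib mult.commute)
  finally show "\<bar>real_of_int q\<bar> ^ (3 * m\<^sup>2) \<le> real_of_int (common_den q m)"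
    using B unfolding B_def[symmetric] by simp
qed

section \<open>A criterion for finiteness of good approximations\<close>

text \<open>Since \<open>(k + 1)^2 / k^2\<close> tends to 1, a strict inequality between leading
  coefficients survives the passage to the next index and any additive constant.\<close>

lemma eventually_quadratic_le:
  fixes \<alpha> \<beta> \<gamma> :: real
  assumes "\<beta> < \<alpha>"
  shows "\<forall>\<^sub>F k in sequentially. \<beta> * (real (Suc k))\<^sup>2 + \<gamma> \<le> \<alpha> * (real k)\<^sup>2"
proof -
  have "\<alpha> - \<beta> > 0" using assms by simp
  then have "filterlim (\<lambda>k. (\<alpha> - \<beta>) * (real k)\<^sup>2 - 2 * \<beta> * real k - \<beta> - \<gamma>) at_top sequentially"
    by real_asymp
  then have "\<forall>\<^sub>F k in sequentially. (\<alpha> - \<beta>) * (real k)\<^sup>2 - 2 * \<beta> * real k - \<beta> - \<gamma> \<ge> 0"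
    unfolding filterlim_at_top by (rule spec)
  then show ?thesis
    by eventually_elim (simp add: algebra_simps power2_eq_square)
qed

text \<open>A good approximation \<open>p / r\<close> is tested against one form
  \<open>a m * x - b m\<close>, of value at most \<open>1 / (2 r)\<close>. If
  \<open>a m * p - b m * r\<close> is nonzero, the error of \<open>p / r\<close> is too large when
  \<open>\<mu> > 1 + \<tau> / \<kappa>\<close>. If it is zero, the form equals
  \<open>a m * (x - p / r)\<close>, and the lower bound on forms excludes this when
  \<open>\<mu> > (\<tau> + \<nu>) / \<kappa>\<close>. Quadratic exponents make consecutive forms
  close enough in size.\<close>

lemma finite_good_approximations:
  fixes x B \<kappa> \<tau> \<nu> \<mu> :: real and a b :: "nat \<Rightarrow> int"
  assumes B: "B > 1" and pos: "\<kappa> > 0" "\<tau> \<ge> 0"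
    and \<mu>: "\<mu> > 1 + \<tau> / \<kappa>" "\<mu> > (\<tau> + \<nu>) / \<kappa>"
    and a: "\<forall>\<^sub>F m in sequentially. \<bar>of_int (a m)\<bar> \<le> B powr (\<tau> * (real m)\<^sup>2)"
    and upper: "\<forall>\<^sub>F m in sequentially. \<bar>of_int (a m) * x - of_int (b m)\<bar> \<le> B powr (- \<kappa> * (real m)\<^sup>2)"
    and lower: "\<forall>\<^sub>F m in sequentially. B powr (- \<nu> * (real m)\<^sup>2) \<le> \<bar>of_int (a m) * x - of_int (b m)\<bar>"
  shows "finite {(p :: int, r :: int). r \<ge> 1 \<and> \<bar>x - of_int p / of_int r\<bar> < 1 / of_int r powr \<mu>}"
proof -
  \<comment> \<open>Writes the factor 2 of \<open>1 / (2 r)\<close> as a power of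
    \<open>B\<close>.\<close>
  define c where "c = log B 2"
  have c: "B powr c = 2" using B by (simp add: c_def)
  have "\<mu> > 1" using \<mu>(1) pos by (smt (verit) divide_nonneg_pos)
  have "\<tau> + \<nu> < \<mu> * \<kappa>" "\<tau> < (\<mu> - 1) * \<kappa>"
    using \<mu> pos by (simp_all add: field_simps)
  from this[THEN eventually_quadratic_le]
  have "\<forall>\<^sub>F k in sequentially. (\<tau> + \<nu>) * (real (Suc k))\<^sup>2 + \<mu> * c \<le> \<mu> * \<kappa> * (real k)\<^sup>2"
    and "\<forall>\<^sub>F k in sequentially. \<tau> * (real (Suc k))\<^sup>2 + \<mu> * c \<le> (\<mu> - 1) * \<kappa> * (real k)\<^sup>2"
    by blast+
  with a upper lower
  have "\<forall>\<^sub>F k in sequentially. \<bar>of_int (a k)\<bar> \<le> B powr (\<tau> * (real k)\<^sup>2) \<and>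
     \<bar>of_int (a k) * x - of_int (b k)\<bar> \<le> B powr (- \<kappa> * (real k)\<^sup>2) \<and>
     B powr (- \<nu> * (real k)\<^sup>2) \<le> \<bar>of_int (a k) * x - of_int (b k)\<bar> \<and>
     (\<tau> + \<nu>) * (real (Suc k))\<^sup>2 + \<mu> * c \<le> \<mu> * \<kappa> * (real k)\<^sup>2 \<and>
     \<tau> * (real (Suc k))\<^sup>2 + \<mu> * c \<le> (\<mu> - 1) * \<kappa> * (real k)\<^sup>2"
    by eventually_elim blast
  then obtain M where M: "\<And>k. k \<ge> M \<Longrightarrow> \<bar>of_int (a k)\<bar> \<le> B powr (\<tau> * (real k)\<^sup>2)"
     "\<And>k. k \<ge> M \<Longrightarrow> \<bar>of_int (a k) * x - of_int (b k)\<bar> \<le> B powr (- \<kappa> * (real k)\<^sup>2)"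
     "\<And>k. k \<ge> M \<Longrightarrow> B powr (- \<nu> * (real k)\<^sup>2) \<le> \<bar>of_int (a k) * x - of_int (b k)\<bar>"
     "\<And>k. k \<ge> M \<Longrightarrow> (\<tau> + \<nu>) * (real (Suc k))\<^sup>2 + \<mu> * c \<le> \<mu> * \<kappa> * (real k)\<^sup>2"
     "\<And>k. k \<ge> M \<Longrightarrow> \<tau> * (real (Suc k))\<^sup>2 + \<mu> * c \<le> (\<mu> - 1) * \<kappa> * (real k)\<^sup>2"
    unfolding eventually_sequentially by blast
  \<comment> \<open>Beyond \<open>r0\<close>, use the form of the least index \<open>m\<close> at which the value is below \<open>1/(2r)\<close>.\<close>
  define r0 where "r0 = B powr (\<kappa> * (real M)\<^sup>2)"
  have r0: "2 * real_of_int r \<le> r0"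
    if r: "r \<ge> 1" and approx: "\<bar>x - of_int p / of_int r\<bar> < 1 / of_int r powr \<mu>" for p r :: int
  proof (rule ccontr)
    assume large: "\<not> 2 * real_of_int r \<le> r0"
    obtain m0 where "log B (2 * of_int r) \<le> \<kappa> * (real m0)\<^sup>2"
      using eventually_quadratic_le[OF pos(1), of "log B (2 * of_int r)"]
      unfolding eventually_sequentially by auto
    then have m0: "2 * real_of_int r \<le> B powr (\<kappa> * (real m0)\<^sup>2)"
      using B r by (simp add: log_le_iff)
    define m where "m = (LEAST m. 2 * real_of_int r \<le> B powr (\<kappa> * (real m)\<^sup>2))"
    have m: "2 * real_of_int r \<le> B powr (\<kappa> * (real m)\<^sup>2)"
      unfolding m_def by (rule LeastI[of _ m0], rule m0)
    have "M < m"
    proof (rule ccontr)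
      assume "\<not> M < m"
      then have "B powr (\<kappa> * (real m)\<^sup>2) \<le> r0"
        unfolding r0_def using B pos by (intro powr_mono mult_left_mono power_mono) auto
      then show False using m large by linarith
    qed
    then obtain k where k: "m = Suc k" "k \<ge> M" by (metis Suc_le_eq Suc_le_D Suc_le_mono)
    \<comment> \<open>Minimality of \<open>m\<close>: the condition fails at the previous index
      \<open>k\<close>, which bounds \<open>r\<close> from below by
      \<open>B powr (\<kappa> * (real k)\<^sup>2 - c)\<close>.\<close>
    have "\<not> 2 * real_of_int r \<le> B powr (\<kappa> * (real k)\<^sup>2)"
      using not_less_Least[of k "\<lambda>m. 2 * real_of_int r \<le> B powr (\<kappa> * (real m)\<^sup>2)"] k
      unfolding m_def by simp
    then have "B powr (\<kappa> * (real k)\<^sup>2 - c) < real_of_int r"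
      by (simp add: powr_diff c)
    then have rpow: "B powr ((\<kappa> * (real k)\<^sup>2 - c) * e) \<le> of_int r powr e" if "e \<ge> 0" for e
      unfolding powr_powr[symmetric] using that by (intro powr_mono2) auto
    define \<delta> where "\<delta> = \<bar>x - of_int p / of_int r\<bar>"
    have \<delta>: "\<delta> < 1 / of_int r powr \<mu>" "\<delta> \<ge> 0" using approx by (simp_all add: \<delta>_def)
    have rpos: "real_of_int r > 0" using r by simp
    have a\<delta>: "\<bar>of_int (a m)\<bar> * \<delta> \<le> B powr (\<tau> * (real m)\<^sup>2) * \<delta>"
      using M(1)[of m] k \<delta> by (intro mult_right_mono) auto
    have split: "of_int (a m) * x - of_int (b m) = of_int (a m) * (x - of_int p / of_int r) + of_int (a m * p - b m * r) / of_int r"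
      using rpos by (simp add: field_simps)
    show False
    proof (cases "a m * p - b m * r = 0")
      case True
      then have "\<bar>of_int (a m) * x - of_int (b m)\<bar> = \<bar>of_int (a m)\<bar> * \<delta>"
        unfolding split \<delta>_def by (simp add: abs_mult)
      then have "B powr (- \<nu> * (real m)\<^sup>2) \<le> B powr (\<tau> * (real m)\<^sup>2) * \<delta>"
        using M(3)[of m] k a\<delta> by simp
      also have "\<dots> < B powr (\<tau> * (real m)\<^sup>2) * (1 / of_int r powr \<mu>)"
        using \<delta> B by (intro mult_strict_left_mono) auto
      finally have "of_int r powr \<mu> * B powr (- \<nu> * (real m)\<^sup>2) < B powr (\<tau> * (real m)\<^sup>2)"
        using rpos by (simp add: field_simps)
      moreover have "B powr ((\<tau> + \<nu>) * (real m)\<^sup>2) \<le> of_int r powr \<mu>"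
      proof -
        have "B powr ((\<tau> + \<nu>) * (real m)\<^sup>2) \<le> B powr ((\<kappa> * (real k)\<^sup>2 - c) * \<mu>)"
          using M(4)[of k] k B by (intro powr_mono) (auto simp: algebra_simps)
        also have "\<dots> \<le> of_int r powr \<mu>" using \<open>\<mu> > 1\<close> by (intro rpow) auto
        finally show ?thesis .
      qed
      then have "B powr ((\<tau> + \<nu>) * (real m)\<^sup>2) * B powr (- \<nu> * (real m)\<^sup>2) \<le> of_int r powr \<mu> * B powr (- \<nu> * (real m)\<^sup>2)"
        by (intro mult_right_mono) auto
      then have "B powr (\<tau> * (real m)\<^sup>2) \<le> of_int r powr \<mu> * B powr (- \<nu> * (real m)\<^sup>2)"
        by (simp add: algebra_simps flip: powr_add)
      ultimately show False by simp
    next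
      case False
      \<comment> \<open>A nonzero integer divided by \<open>r\<close> is at least
        \<open>1 / r\<close> in absolute value. The form accounts for at most half of this, so
        \<open>a m\<close> times the error must supply the rest.\<close>
      then have "1 \<le> \<bar>a m * p - b m * r\<bar>" by simp
      then have "1 \<le> \<bar>real_of_int (a m * p - b m * r)\<bar>" by linarith
      then have "1 / of_int r \<le> \<bar>of_int (a m * p - b m * r) / of_int r :: real\<bar>"
        using rpos by (simp add: abs_divide divide_right_mono del: of_int_diff of_int_mult)
      also have "\<dots> \<le> \<bar>of_int (a m) * x - of_int (b m)\<bar> + \<bar>of_int (a m)\<bar> * \<delta>"
        unfolding split \<delta>_def abs_mult[symmetric] by linarith
      also have "\<bar>of_int (a m) * x - of_int (b m)\<bar> \<le> 1 / (2 * of_int r)"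
      proof -
        have "\<bar>of_int (a m) * x - of_int (b m)\<bar> \<le> 1 / B powr (\<kappa> * (real m)\<^sup>2)"
          using M(2)[of m] k by (simp add: powr_minus_divide)
        also have "\<dots> \<le> 1 / (2 * of_int r)" using m rpos B by (intro divide_left_mono mult_pos_pos) auto
        finally show ?thesis .
      qed
      finally have "1 / (2 * of_int r) \<le> \<bar>of_int (a m)\<bar> * \<delta>" by simp
      also note a\<delta>
      also have "B powr (\<tau> * (real m)\<^sup>2) * \<delta> < B powr (\<tau> * (real m)\<^sup>2) * (1 / of_int r powr \<mu>)"
        using \<delta> B by (intro mult_strict_left_mono) auto
      finally have "of_int r powr \<mu> < B powr (\<tau> * (real m)\<^sup>2) * 2 * of_int r"
        using rpos by (simp add: field_simps)
      moreover have "of_int r powr \<mu> = of_int r powr (\<mu> - 1) * of_int r"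
        using rpos powr_add[of "of_int r" "\<mu> - 1" 1] by simp
      ultimately have "of_int r powr (\<mu> - 1) < B powr (\<tau> * (real m)\<^sup>2) * 2"
        using rpos by simp
      also have "\<dots> = B powr (\<tau> * (real m)\<^sup>2 + c)" by (simp add: powr_add c)
      also have "\<dots> \<le> B powr ((\<kappa> * (real k)\<^sup>2 - c) * (\<mu> - 1))"
        using M(5)[of k] k B by (intro powr_mono) (auto simp: algebra_simps)
      also have "\<dots> \<le> of_int r powr (\<mu> - 1)" using \<open>\<mu> > 1\<close> by (intro rpow) auto
      finally show False by simp
    qed
  qed
  \<comment> \<open>Once \<open>r\<close> is bounded, so is \<open>p\<close>, because
    \<open>p / r\<close> lies within 1 of \<open>x\<close>.\<close>
  define N where "N = \<lceil>r0 * (\<bar>x\<bar> + 1)\<rceil>"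
  have "{(p :: int, r :: int). r \<ge> 1 \<and> \<bar>x - of_int p / of_int r\<bar> < 1 / of_int r powr \<mu>}
     \<subseteq> {- N..N} \<times> {1..\<lceil>r0\<rceil>}"
  proof safe
    fix p r :: int
    assume r: "r \<ge> 1" and approx: "\<bar>x - of_int p / of_int r\<bar> < 1 / of_int r powr \<mu>"
    have "2 * real_of_int r \<le> r0" using r0[OF r approx] .
    then have rr0: "real_of_int r \<le> r0" using r by linarith
    then show "r \<in> {1..\<lceil>r0\<rceil>}" using r by (simp add: le_ceiling_iff)
    have "1 / of_int r powr \<mu> \<le> 1"
      using r \<open>\<mu> > 1\<close> by (simp add: ge_one_powr_ge_zero)
    then have "\<bar>of_int p / of_int r\<bar> \<le> \<bar>x\<bar> + 1" using approx by linarith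
    then have "\<bar>real_of_int p\<bar> \<le> of_int r * (\<bar>x\<bar> + 1)"
      using r by (simp add: abs_divide field_simps)
    also have "\<dots> \<le> r0 * (\<bar>x\<bar> + 1)" using rr0 by (intro mult_right_mono) auto
    also have "\<dots> \<le> of_int N" unfolding N_def by (rule le_of_int_ceiling)
    finally show "p \<in> {- N..N}" by simp linarith
  qed
  then show ?thesis by (rule finite_subset) simp
qed

text \<open>The pairs \<open>(p, r)\<close> need not be coprime: a rational number has infinitely many representations.\<close>
lemma irrational_if_finite_approximations:
  fixes x \<mu> :: real
  assumes "finite {(p :: int, r :: int). r \<ge> 1 \<and> \<bar>x - of_int p / of_int r\<bar> < 1 / of_int r powr \<mu>}"
  shows "x \<notin> \<rat>"
proof
  assume "x \<in> \<rat>"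
  then obtain p r :: int where r: "r > 0" and x: "x = of_int p / of_int r"
    by (rule Rats_cases')
  have "(\<lambda>k :: nat. (int (Suc k) * p, int (Suc k) * r)) ` UNIV \<subseteq>
     {(p :: int, r :: int). r \<ge> 1 \<and> \<bar>x - of_int p / of_int r\<bar> < 1 / of_int r powr \<mu>}"
  proof safe
    fix k :: nat
    have pos: "int (Suc k) * r > 0" using r by (intro mult_pos_pos) auto
    then show "1 \<le> int (Suc k) * r" by linarith
    have "x = of_int (int (Suc k) * p) / of_int (int (Suc k) * r)"
      unfolding x of_int_mult by (rule mult_divide_mult_cancel_left[symmetric]) (simp del: of_nat_Suc)
    then show "\<bar>x - of_int (int (Suc k) * p) / of_int (int (Suc k) * r)\<bar> < 1 / of_int (int (Suc k) * r) powr \<mu>"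
      using r by (simp del: of_int_mult)
  qed
  then have "finite (range (\<lambda>k :: nat. (int (Suc k) * p, int (Suc k) * r)))"
    using assms by (rule finite_subset)
  moreover have "inj (\<lambda>k :: nat. (int (Suc k) * p, int (Suc k) * r))"
    using r by (auto intro: injI)
  ultimately have "finite (UNIV :: nat set)"
    by (rule finite_imageD)
  then show False by simp
qed

section \<open>The irrationality measure of Ln_q(2)\<close>

lemma Ln_q2_eq_suminf: "Ln_q2 q = suminf (lambert_term (of_int q))"
  by (simp add: Ln_q2_def lambert_term_def[abs_def])

text \<open>The forms for \<open>n = 2m\<close>, multiplied by the common denominator. The leading
  exponents 9, -3 and -3 are relaxed by 0.2 to absorb the linear terms; the largest of these,
  \<open>10 m \<le> 0.2 m^2\<close>, is the source of \<open>m \<ge> 50\<close>.\<close>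

lemma Ln_q2_approximations:
  fixes q :: int and m :: nat
  defines "B \<equiv> \<bar>real_of_int q\<bar>"
  assumes q: "\<bar>q\<bar> \<ge> 2" and m: "m \<ge> 50"
  obtains a b :: int where
    "\<bar>of_int a\<bar> \<le> B powr (9.2 * (real m)\<^sup>2)"
    "\<bar>of_int a * Ln_q2 q - of_int b\<bar> \<le> B powr (- 2.8 * (real m)\<^sup>2)"
    "B powr (- 3.2 * (real m)\<^sup>2) \<le> \<bar>of_int a * Ln_q2 q - of_int b\<bar>"
proof -
  let ?p = "real_of_int q"
  have B: "B \<ge> 2" using q unfolding B_def by linarith
  then have p: "\<bar>?p\<bar> \<ge> 2" by (simp add: B_def)
  have B1: "B > 1" using B by simp
  define D where "D = real_of_int (common_den q m)"
  have D: "B ^ (3 * m\<^sup>2) \<le> D" "D \<le> B ^ (3 * m\<^sup>2 + m)"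
    using common_den_bounds[OF q, of m] by (simp_all add: D_def B_def)
  have D0: "D > 0" using D(1) B by (intro less_le_trans[OF _ D(1)]) simp
  define R where "R = approx_den ?p (2 * m) * Ln_q2 q - approx_num ?p (2 * m)"
  have sum: "2 * m * Suc (2 * m) + (\<Sum>l\<le>2*m. l) = 6 * m\<^sup>2 + 3 * m"
  proof -
    have "(\<Sum>l\<le>2*m. l) = 2 * m\<^sup>2 + m"
      by (induction m) (auto simp: power2_eq_square)
    then show ?thesis by (simp add: power2_eq_square)
  qed
  have R: "\<bar>R\<bar> \<le> B ^ (2 * (2 * m) + 2) / B ^ (6 * m\<^sup>2 + 3 * m)"
    "1 / B ^ (6 * m\<^sup>2 + 3 * m + 2 * (2 * m) + 2) \<le> \<bar>R\<bar>"
    using remainder_bounds[OF p, of "2 * m" R] m unfolding R_def Ln_q2_eq_suminf sum B_def by auto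
  have pw: "B ^ k = B powr real k" for k using B by (simp add: powr_realpow)
  have large: "50 * real m \<le> (real m)\<^sup>2" "50 \<le> real m"
    using m by (simp_all add: power2_eq_square)
  obtain a where a: "D * approx_den ?p (2 * m) = of_int a"
    using Ints_mult[OF Ints_of_int approx_den_in_Ints[of ?p "2 * m"], of "common_den q m"]
    unfolding D_def by (auto elim!: Ints_cases)
  have "q \<noteq> 0" using q by auto
  then obtain b where b: "D * approx_num ?p (2 * m) = of_int b"
    using approx_num_in_Ints[of q m] unfolding D_def by (auto elim!: Ints_cases)
  have DR: "of_int a * Ln_q2 q - of_int b = D * R"
    unfolding a[symmetric] b[symmetric] R_def by (simp add: algebra_simps)
  have "\<bar>of_int a\<bar> = D * \<bar>approx_den ?p (2 * m)\<bar>"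
    using D0 unfolding a[symmetric] by (simp add: abs_mult)
  also have "\<dots> \<le> B ^ (3 * m\<^sup>2 + m) * B ^ (6 * m\<^sup>2 + 9 * m)"
    using D D0 abs_approx_den_le[OF p, of m] B unfolding B_def[symmetric] by (intro mult_mono) auto
  also have "\<dots> = B powr (9 * (real m)\<^sup>2 + 10 * real m)"
    unfolding pw powr_add[symmetric] by (intro arg_cong[of _ _ "(powr) B"]) simp
  also have "\<dots> \<le> B powr (9.2 * (real m)\<^sup>2)"
    by (rule powr_mono) (use B1 large in linarith)+
  finally have 1: "\<bar>of_int a\<bar> \<le> B powr (9.2 * (real m)\<^sup>2)" .
  have "\<bar>D * R\<bar> = D * \<bar>R\<bar>" using D0 by (simp add: abs_mult)
  also have "\<dots> \<le> B ^ (3 * m\<^sup>2 + m) * (B ^ (2 * (2 * m) + 2) / B ^ (6 * m\<^sup>2 + 3 * m))"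
    using D R D0 B by (intro mult_mono) auto
  also have "\<dots> = B powr (- 3 * (real m)\<^sup>2 + 2 * real m + 2)"
    unfolding pw powr_add[symmetric] powr_diff[symmetric] by (intro arg_cong[of _ _ "(powr) B"]) simp
  also have "\<dots> \<le> B powr (- 2.8 * (real m)\<^sup>2)"
    by (rule powr_mono) (use B1 large in linarith)+
  finally have 2: "\<bar>D * R\<bar> \<le> B powr (- 2.8 * (real m)\<^sup>2)" .
  have "B powr (- 3.2 * (real m)\<^sup>2) \<le> B powr (- 3 * (real m)\<^sup>2 - 7 * real m - 2)"
    by (rule powr_mono) (use B1 large in linarith)+
  also have "\<dots> = B ^ (3 * m\<^sup>2) * (1 / B ^ (6 * m\<^sup>2 + 3 * m + 2 * (2 * m) + 2))"
    unfolding times_divide_eq_right mult_1_right pw powr_diff[symmetric] by (intro arg_cong[of _ _ "(powr) B"]) simp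
  also have "\<dots> \<le> D * \<bar>R\<bar>"
    using D R D0 B by (intro mult_mono) auto
  also have "\<dots> = \<bar>D * R\<bar>" using D0 by (simp add: abs_mult)
  finally have 3: "B powr (- 3.2 * (real m)\<^sup>2) \<le> \<bar>D * R\<bar>" .
  show ?thesis using that[of a b] 1 2 3 unfolding DR by blast
qed

theorem theorem2:
  fixes q :: int
  assumes "\<bar>q\<bar> \<noteq> 0" and "\<bar>q\<bar> \<noteq> 1"
  shows "Ln_q2 q \<notin> \<rat> \<and> irrationality_measure (Ln_q2 q) \<le> ereal 4.8"
proof -
  have q: "\<bar>q\<bar> \<ge> 2" using assms by linarith
  define B where "B = \<bar>real_of_int q\<bar>"
  have B: "B > 1" using q unfolding B_def by linarith
  define good where "good m a b \<longleftrightarrow> \<bar>of_int a\<bar> \<le> B powr (9.2 * (real m)\<^sup>2) \<and>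
    \<bar>of_int a * Ln_q2 q - of_int b\<bar> \<le> B powr (- 2.8 * (real m)\<^sup>2) \<and>
    B powr (- 3.2 * (real m)\<^sup>2) \<le> \<bar>of_int a * Ln_q2 q - of_int b\<bar>" for m :: nat and a b :: int
  have "\<exists>a b. good m a b" if "m \<ge> 50" for m
    using Ln_q2_approximations[OF q that] unfolding good_def B_def by metis
  then obtain a b where "\<And>m. m \<ge> 50 \<Longrightarrow> good m (a m) (b m)" by metis
  then have "\<forall>\<^sub>F m in sequentially. good m (a m) (b m)"
    by (auto simp: eventually_sequentially)
  then have ev: "\<forall>\<^sub>F m in sequentially. \<bar>of_int (a m)\<bar> \<le> B powr (9.2 * (real m)\<^sup>2)"
    "\<forall>\<^sub>F m in sequentially. \<bar>of_int (a m) * Ln_q2 q - of_int (b m)\<bar> \<le> B powr (- 2.8 * (real m)\<^sup>2)"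
    "\<forall>\<^sub>F m in sequentially. B powr (- 3.2 * (real m)\<^sup>2) \<le> \<bar>of_int (a m) * Ln_q2 q - of_int (b m)\<bar>"
    unfolding good_def by (auto elim: eventually_mono)
  \<comment> \<open>Here \<open>\<tau> = 9.2\<close>, \<open>\<kappa> = 2.8\<close> and
    \<open>\<nu> = 3.2\<close>: both \<open>1 + 9.2 / 2.8 < 4.3\<close> and
    \<open>(9.2 + 3.2) / 2.8 < 4.5\<close> are below 4.8.\<close>
  have fin: "finite {(p :: int, r :: int). r \<ge> 1 \<and>
      \<bar>Ln_q2 q - of_int p / of_int r\<bar> < 1 / of_int r powr 4.8}"
    by (rule finite_good_approximations[OF B _ _ _ _ ev]) simp_all
  then have "irrationality_measure (Ln_q2 q) \<le> ereal 4.8"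
    unfolding irrationality_measure_def by (intro Inf_lower) blast
  with fin show ?thesis using irrational_if_finite_approximations by blast
qed

end
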